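(* Let $n\ge 3$ and let $(\mathbf{A},[\cdot,\cdot])$ be an $n$-dimensional anticommutative complex algebra whose annihilator has dimension $n-3$. Then the following hold, where the algebras $\mathbf{A}_{n,i}$ are given by their multiplication on a basis $e_1,\dots,e_n$ (families carry a parameter $\alpha$, and "$\mathbf{A}\cong\mathbf{A}_{n,i}$" for a family means that $\mathbf{A}$ is isomorphic to a member of the family for some admissible value of $\alpha$). (1) If $n=3$, then $\mathbf{A}\cong \mathbf{A}_{3,i}$ for some $i\in\{1,\dots,6\}$, where - $\mathbf{A}_{3,1}=\mathfrak{g}_2$: $[e_1,e_3]=e_1$, $[e_2,e_3]=e_2$; - $\mathbf{A}_{3,2}=\mathfrak{g}_3^{\alpha}$ with $\alpha\in\mathbb{C}^*_{>1}\cup\{1\}$: $[e_1,e_3]=e_1+e_2$, $[e_2,e_3]=\alpha e_2$; - $\mathbf{A}_{3,3}=\mathfrak{g}_4$: $[e_1,e_2]=e_3$, $[e_1,e_3]=-e_2$, $[e_2,e_3]=e_1$; - $\mathbf{A}_{3,4}=\mathcal{A}_1^{\alpha}$ with $\alpha\in\mathbb{C}^*_{>1}\cup\{0,1\}$: $[e_1,e_2]=e_3$, $[e_1,e_3]=e_1+e_3$, $[e_2,e_3]=\alpha e_2$; - $\mathbf{A}_{3,5}=\mathcal{A}_2$: $[e_1,e_2]=e_1$, $[e_2,e_3]=e_2$; - $\mathbf{A}_{3,6}=\mathcal{A}_3$: $[e_1,e_2]=e_3$, $[e_1,e_3]=e_1$, $[e_2,e_3]=e_2$. (2) If $n=4$,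 then $\mathbf{A}\cong\mathbf{A}_{4,i}$ for some $i\in\{1,\dots,12\}$, where the following algebras are pairwise non-isomorphic: - $\mathbf{A}_{4,i}=\mathbf{A}_{3,i}\oplus\mathbb{C}e_4$ for $i=1,\dots,6$; - $\mathbf{A}_{4,7}$: $[e_1,e_2]=e_4$, $[e_2,e_3]=e_1$; - $\mathbf{A}_{4,8}$: $[e_1,e_2]=e_4$, $[e_1,e_3]=e_1$, $[e_2,e_3]=e_2$; - $\mathbf{A}_{4,9}$ with $\alpha\in\mathbb{C}^*_{>1}\cup\{0,1\}$: $[e_1,e_2]=e_4$, $[e_1,e_3]=e_1+e_2$, $[e_2,e_3]=\alpha e_2$; - $\mathbf{A}_{4,10}$: $[e_1,e_3]=e_1+e_2$, $[e_2,e_3]=e_4$; - $\mathbf{A}_{4,11}$: $[e_1,e_2]=e_3$, $[e_1,e_3]=e_1+e_3$, $[e_2,e_3]=e_4$; - $\mathbf{A}_{4,12}$: $[e_1,e_2]=e_1$, $[e_1,e_3]=e_4$, $[e_2,e_3]=e_2$. (3) If $n=5$, then $\mathbf{A}\cong\mathbf{A}_{5,i}$ for some $i\in\{1,\dots,15\}$, where the following algebras are pairwise non-isomorphic: - $\mathbf{A}_{5,i}=\mathbf{A}_{4,i}\oplus\mathbb{C}e_5$ for $i=1,\dots,12$; - $\mathbf{A}_{5,13}$: $[e_1,e_3]=e_4$, $[e_2,e_3]=e_5$; - $\mathbf{A}_{5,14}$: $[e_1,e_2]=e_4$, $[e_1,e_3]=e_5$, $[e_2,e_3]=e_1$; - $\mathbf{A}_{5,15}$: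 $[e_1,e_2]=e_4$, $[e_1,e_3]=e_1+e_2$, $[e_2,e_3]=e_5$. (4) If $n=6$, then $\mathbf{A}\cong\mathbf{A}_{6,i}$ for some $i\in\{1,\dots,16\}$, where the following algebras are pairwise non-isomorphic: - $\mathbf{A}_{6,i}=\mathbf{A}_{5,i}\oplus\mathbb{C}e_6$ for $i=1,\dots,15$; - $\mathbf{A}_{6,16}$: $[e_1,e_2]=e_4$, $[e_1,e_3]=e_5$, $[e_2,e_3]=e_6$. (5) If $n\ge 7$, then $\mathbf{A}\cong\mathbf{A}_{n,i}$ for some $i\in\{1,\dots,16\}$, where $\mathbf{A}_{n,i}=\mathbf{A}_{6,i}\oplus\mathbb{C}e_7\oplus\cdots\oplus\mathbb{C}e_n$.
   Context: An anticommutative algebra over a field $\mathbf{k}$ of characteristic not $2$ is a $\mathbf{k}$-vector space $\mathbf{A}$ with a bilinear product $[\cdot,\cdot]$ satisfying $[x,y]=-[y,x]$ for all $x,y$ (no Jacobi identity is assumed). Its annihilator is $\mathrm{Ann}(\mathbf{A})=\{x\in\mathbf{A}: [x,y]=0 \text{ for all } y\in\mathbf{A}\}$. Convention for multiplication tables: products of basis elements that are not listed and cannot be recovered from anticommutativity are zero. The notation $\mathbf{B}\oplus\mathbb{C}e_k$ denotes the direct sum of algebras (of two ideals), where $\mathbb{C}e_k$ is one-dimensional with zero multiplication, so that $e_k$ lies in the annihilator. Parameter set: $\mathbb{C}^*=\mathbb{C}\setminus\{0\}$ and $$\mathbb{C}^*_{>1}=\{\alpha\in\mathbb{C}^*: |\alpha|>1\}\cup\{\alpha\in\mathbb{C}^*: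 |\alpha|=1,\ 0<\arg(\alpha)\le\pi\}.$$ In the lists asserted to be pairwise non-isomorphic, each family consists of one algebra for every admissible value of its parameter $\alpha$; algebras with different indices $i$, or with the same index and different parameter values, count as different members of the list. *)

theory Defs
  imports Complex_Main "HOL-Library.Function_Algebras"
begin

section \<open>Anticommutative algebras\<close>

text \<open>
  An algebra is given by the scalar multiplication of an ambient vector space, a subspace
  \<open>V\<close> of it (the underlying space of the algebra; \<open>V = UNIV\<close> is allowed), and a product
  \<open>br\<close> that only matters on \<open>V\<close>. Carriers are sets, not types, so that the dimension can
  be an arbitrary natural number.
\<close>

locale anticommutative_algebra = vector_space scale
  for scale :: "'k::field \<Rightarrow> 'v::ab_group_add \<Rightarrow> 'v" +
  fixes V :: "'v set" and br :: "'v \<Rightarrow> 'v \<Rightarrow> 'v"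
  assumes char_not_2: "(2::'k) \<noteq> 0"
    and subspace_V: "subspace V"
    and br_closed: "x \<in> V \<Longrightarrow> y \<in> V \<Longrightarrow> br x y \<in> V"
    and br_add_left: "x \<in> V \<Longrightarrow> y \<in> V \<Longrightarrow> z \<in> V \<Longrightarrow> br (x + y) z = br x z + br y z"
    and br_add_right: "x \<in> V \<Longrightarrow> y \<in> V \<Longrightarrow> z \<in> V \<Longrightarrow> br x (y + z) = br x y + br x z"
    and br_scale_left: "x \<in> V \<Longrightarrow> y \<in> V \<Longrightarrow> br (scale c x) y = scale c (br x y)"
    and br_scale_right: "x \<in> V \<Longrightarrow> y \<in> V \<Longrightarrow> br x (scale c y) = scale c (br x y)"
    and br_anticomm: "x \<in> V \<Longrightarrow> y \<in> V \<Longrightarrow> br x y = - br y x"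

definition annihilator :: "'v set \<Rightarrow> ('v \<Rightarrow> 'v \<Rightarrow> 'v::zero) \<Rightarrow> 'v set" where
  "annihilator V br = {x \<in> V. \<forall>y\<in>V. br x y = 0}"

definition algebra_iso ::
  "('k \<Rightarrow> 'v::plus \<Rightarrow> 'v) \<Rightarrow> 'v set \<Rightarrow> ('v \<Rightarrow> 'v \<Rightarrow> 'v) \<Rightarrow>
   ('k \<Rightarrow> 'w::plus \<Rightarrow> 'w) \<Rightarrow> 'w set \<Rightarrow> ('w \<Rightarrow> 'w \<Rightarrow> 'w) \<Rightarrow> bool" where
  "algebra_iso sV V brV sW W brW \<longleftrightarrow>
    (\<exists>f. bij_betw f V W \<and>
         (\<forall>x\<in>V. \<forall>y\<in>V. f (x + y) = f x + f y) \<and>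
         (\<forall>c. \<forall>x\<in>V. f (sV c x) = sW c (f x)) \<and>
         (\<forall>x\<in>V. \<forall>y\<in>V. f (brV x y) = brW (f x) (f y)))"


section \<open>Coordinate spaces and multiplication tables\<close>

text \<open>
  The space with basis \<open>\<ee> 1, \<dots>, \<ee> n\<close> consists of the sequences supported in \<open>{1..n}\<close>.
  Addition of sequences is pointwise, from \<^theory>\<open>HOL-Library.Function_Algebras\<close>.
\<close>

definition vscale :: "complex \<Rightarrow> (nat \<Rightarrow> complex) \<Rightarrow> (nat \<Rightarrow> complex)" (infixr "*\<^sub>c" 75) where
  "c *\<^sub>c x = (\<lambda>i. c * x i)"

definition \<ee> :: "nat \<Rightarrow> (nat \<Rightarrow> complex)" where
  "\<ee> k = (\<lambda>i. if i = k then 1 else 0)"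

definition coord_space :: "nat \<Rightarrow> (nat \<Rightarrow> complex) set" where
  "coord_space n = {x. \<forall>i. i \<notin> {1..n} \<longrightarrow> x i = 0}"

text \<open>
  The bilinear anticommutative product determined by
  \<open>[\<ee> 1, \<ee> 2] = p\<close>, \<open>[\<ee> 1, \<ee> 3] = q\<close>, \<open>[\<ee> 2, \<ee> 3] = r\<close> and \<open>[\<ee> i, \<ee> j] = 0\<close> for all other
  \<open>i < j\<close>. It does not mention \<open>n\<close>: on \<open>coord_space (Suc n)\<close> with \<open>n \<ge> 3\<close> it is the direct
  sum of its restriction to \<open>coord_space n\<close> and of the one-dimensional algebra spanned by
  \<open>\<ee> (Suc n)\<close> with zero product; see \<open>table_direct_sum\<close> below.
\<close>

definition table ::
  "(nat \<Rightarrow> complex) \<Rightarrow> (nat \<Rightarrow> complex) \<Rightarrow> (nat \<Rightarrow> complex) \<Rightarrow>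
   (nat \<Rightarrow> complex) \<Rightarrow> (nat \<Rightarrow> complex) \<Rightarrow> (nat \<Rightarrow> complex)" where
  "table p q r x y =
     (x 1 * y 2 - x 2 * y 1) *\<^sub>c p +
     (x 1 * y 3 - x 3 * y 1) *\<^sub>c q +
     (x 2 * y 3 - x 3 * y 2) *\<^sub>c r"


section \<open>The algebras of the classification\<close>

text \<open>
  \<open>A_br i \<alpha>\<close> is the product of the \<open>i\<close>-th algebra (of every dimension in which that
  algebra occurs). Only the products with \<open>i \<in> {2, 4, 9}\<close> depend on \<open>\<alpha>\<close>.
\<close>

definition A_br :: "nat \<Rightarrow> complex \<Rightarrow> (nat \<Rightarrow> complex) \<Rightarrow> (nat \<Rightarrow> complex) \<Rightarrow> (nat \<Rightarrow> complex)" where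
  "A_br i \<alpha> =
    (if i = 1 then table 0 (\<ee> 1) (\<ee> 2)
     else if i = 2 then table 0 (\<ee> 1 + \<ee> 2) (\<alpha> *\<^sub>c \<ee> 2)
     else if i = 3 then table (\<ee> 3) (- \<ee> 2) (\<ee> 1)
     else if i = 4 then table (\<ee> 3) (\<ee> 1 + \<ee> 3) (\<alpha> *\<^sub>c \<ee> 2)
     else if i = 5 then table (\<ee> 1) 0 (\<ee> 2)
     else if i = 6 then table (\<ee> 3) (\<ee> 1) (\<ee> 2)
     else if i = 7 then table (\<ee> 4) 0 (\<ee> 1)
     else if i = 8 then table (\<ee> 4) (\<ee> 1) (\<ee> 2)
     else if i = 9 then table (\<ee> 4) (\<ee> 1 + \<ee> 2) (\<alpha> *\<^sub>c \<ee> 2)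
     else if i = 10 then table 0 (\<ee> 1 + \<ee> 2) (\<ee> 4)
     else if i = 11 then table (\<ee> 3) (\<ee> 1 + \<ee> 3) (\<ee> 4)
     else if i = 12 then table (\<ee> 1) (\<ee> 4) (\<ee> 2)
     else if i = 13 then table 0 (\<ee> 4) (\<ee> 5)
     else if i = 14 then table (\<ee> 4) (\<ee> 5) (\<ee> 1)
     else if i = 15 then table (\<ee> 4) (\<ee> 1 + \<ee> 2) (\<ee> 5)
     else if i = 16 then table (\<ee> 4) (\<ee> 5) (\<ee> 6)
     else table 0 0 0)"

definition C_gt1 :: "complex set" where
  "C_gt1 = {\<alpha>. \<alpha> \<noteq> 0 \<and> cmod \<alpha> > 1} \<union> {\<alpha>. \<alpha> \<noteq> 0 \<and> cmod \<alpha> = 1 \<and> 0 < Arg \<alpha> \<and> Arg \<alpha> \<le> pi}"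

text \<open>
  Algebras without a parameter get the single dummy value \<open>0\<close>, so that they occur exactly
  once in \<open>members m\<close>.
\<close>

definition params :: "nat \<Rightarrow> complex set" where
  "params i = (if i = 2 then C_gt1 \<union> {1}
               else if i = 4 \<or> i = 9 then C_gt1 \<union> {0, 1}
               else {0})"

definition members :: "nat \<Rightarrow> (nat \<times> complex) set" where
  "members m = {(i, \<alpha>). i \<in> {1..m} \<and> \<alpha> \<in> params i}"

definition pairwise_non_isomorphic :: "nat \<Rightarrow> nat \<Rightarrow> bool" where
  "pairwise_non_isomorphic n m \<longleftrightarrow>
     pairwise (\<lambda>(i, \<alpha>) (j, \<beta>).
       \<not> algebra_iso vscale (coord_space n) (A_br i \<alpha>) vscale (coord_space n) (A_br j \<beta>))
     (members m)"


section \<open>Basic facts on the definitions\<close>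

lemma vector_space_vscale: "vector_space vscale"
  by unfold_locales (auto simp: vscale_def fun_eq_iff algebra_simps)

lemma e_in_coord_space: "1 \<le> k \<Longrightarrow> k \<le> n \<Longrightarrow> \<ee> k \<in> coord_space n"
  by (auto simp: \<ee>_def coord_space_def)

lemma coord_space_closed:
  "0 \<in> coord_space n"
  "x \<in> coord_space n \<Longrightarrow> y \<in> coord_space n \<Longrightarrow> x + y \<in> coord_space n"
  "x \<in> coord_space n \<Longrightarrow> - x \<in> coord_space n"
  "x \<in> coord_space n \<Longrightarrow> c *\<^sub>c x \<in> coord_space n"
  by (auto simp: coord_space_def vscale_def)

lemma subspace_coord_space: "module.subspace vscale (coord_space n)"
proof -
  interpret vector_space vscale by (rule vector_space_vscale)
  show ?thesis
    by (auto simp: subspace_def coord_space_closed)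
qed

lemma sum_fun_apply: "finite S \<Longrightarrow> (\<Sum>k\<in>S. f k) i = (\<Sum>k\<in>S. (f k :: nat \<Rightarrow> complex) i)"
  by (induction S rule: finite_induct) auto

lemma sum_\<ee>_apply: "(\<Sum>k\<in>{1..n}. u k *\<^sub>c \<ee> k) i = (if i \<in> {1..n} then u i else 0)"
  by (simp add: sum_fun_apply vscale_def \<ee>_def if_distrib[of "\<lambda>t. _ * t"] sum.delta'
      cong: if_cong)

lemma coord_space_eq_span: "coord_space n = module.span vscale (\<ee> ` {1..n})"
proof -
  interpret vector_space vscale by (rule vector_space_vscale)
  show ?thesis
  proof
    show "span (\<ee> ` {1..n}) \<subseteq> coord_space n"
      by (rule span_minimal) (auto simp: e_in_coord_space subspace_coord_space)
    show "coord_space n \<subseteq> span (\<ee> ` {1..n})"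
    proof
      fix x assume "x \<in> coord_space n"
      then have "x = (\<Sum>k\<in>{1..n}. x k *\<^sub>c \<ee> k)"
        unfolding fun_eq_iff sum_\<ee>_apply by (simp add: coord_space_def)
      also have "\<dots> \<in> span (\<ee> ` {1..n})"
        by (intro span_sum span_scale span_base) auto
      finally show "x \<in> span (\<ee> ` {1..n})" .
    qed
  qed
qed

lemma dim_coord_space: "vector_space.dim vscale (coord_space n) = n"
proof -
  interpret vector_space vscale by (rule vector_space_vscale)
  have inj: "inj_on \<ee> {1..n}"
    by (auto simp: inj_on_def \<ee>_def fun_eq_iff split: if_splits)
  have "u (\<ee> j) = 0" if "(\<Sum>v\<in>\<ee> ` {1..n}. u v *\<^sub>c v) = 0" "j \<in> {1..n}" for u j
  proof -
    have "(\<Sum>k\<in>{1..n}. u (\<ee> k) *\<^sub>c \<ee> k) j = 0"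
      using that(1) unfolding sum.reindex[OF inj] o_def by simp
    then show ?thesis
      using that(2) unfolding sum_\<ee>_apply by simp
  qed
  then have "independent (\<ee> ` {1..n})"
    by (subst dependent_finite) auto
  then show ?thesis
    using dim_span_eq_card_independent[of "\<ee> ` {1..n}"] card_image[OF inj]
    by (simp add: coord_space_eq_span)
qed

lemma anticommutative_algebra_table:
  assumes "p \<in> coord_space n" "q \<in> coord_space n" "r \<in> coord_space n"
  shows "anticommutative_algebra vscale (coord_space n) (table p q r)"
proof -
  interpret vector_space vscale by (rule vector_space_vscale)
  show ?thesis
  proof unfold_locales
    show "subspace (coord_space n)" by (rule subspace_coord_space)
    show "table p q r x y \<in> coord_space n" for x y
      unfolding table_def using assms by (intro coord_space_closed)
  qed (auto simp: table_def vscale_def fun_eq_iff algebra_simps)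
qed

lemma table_e:
  "table p q r (\<ee> 1) (\<ee> 2) = p" "table p q r (\<ee> 1) (\<ee> 3) = q" "table p q r (\<ee> 2) (\<ee> 3) = r"
  "k > 3 \<Longrightarrow> table p q r x (\<ee> k) = 0"
  by (auto simp: table_def vscale_def \<ee>_def fun_eq_iff)

lemma table_direct_sum:
  assumes "n \<ge> 3" "x \<in> coord_space (Suc n)"
  shows "\<exists>!(y, c). y \<in> coord_space n \<and> x = y + c *\<^sub>c \<ee> (Suc n)"
    and "table p q r (y + c *\<^sub>c \<ee> (Suc n)) (y' + c' *\<^sub>c \<ee> (Suc n)) = table p q r y y'"
proof -
  show "\<exists>!(y, c). y \<in> coord_space n \<and> x = y + c *\<^sub>c \<ee> (Suc n)"
  proof (rule ex1I[of _ "(\<lambda>i. if i = Suc n then 0 else x i, x (Suc n))"])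
    show "case (\<lambda>i. if i = Suc n then 0 else x i, x (Suc n)) of
        (y, c) \<Rightarrow> y \<in> coord_space n \<and> x = y + c *\<^sub>c \<ee> (Suc n)"
      using assms(2) by (auto simp: coord_space_def vscale_def \<ee>_def fun_eq_iff)
  next
    fix z :: "(nat \<Rightarrow> complex) \<times> complex"
    assume "case z of (y, c) \<Rightarrow> y \<in> coord_space n \<and> x = y + c *\<^sub>c \<ee> (Suc n)"
    then show "z = (\<lambda>i. if i = Suc n then 0 else x i, x (Suc n))"
      by (cases z) (auto simp: coord_space_def vscale_def \<ee>_def fun_eq_iff)
  qed
  show "table p q r (y + c *\<^sub>c \<ee> (Suc n)) (y' + c' *\<^sub>c \<ee> (Suc n)) = table p q r y y'"
    using assms(1) by (simp add: table_def vscale_def \<ee>_def)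
qed

lemma anticommutative_algebra_A_br:
  assumes "n \<ge> 3" and "i \<in> {1..6} \<or> (n \<ge> 4 \<and> i \<le> 12) \<or> (n \<ge> 5 \<and> i \<le> 15) \<or> n \<ge> 6"
  shows "anticommutative_algebra vscale (coord_space n) (A_br i \<alpha>)"
  unfolding A_br_def using assms
  by (auto intro!: anticommutative_algebra_table coord_space_closed e_in_coord_space)

end

theory Submission
  imports Defs "HOL-Analysis.Analysis"
begin

text \<open>
  Choose a \<^emph>\<open>frame\<close> of the algebra, that is, three vectors forming a basis modulo the
  annihilator. In the coordinates \<open>x, y\<close> of such a frame the product is, modulo the
  annihilator, \<open>N (x \<times> y)\<close> for a 3 by 3 \<^emph>\<open>structure matrix\<close> \<open>N\<close>.
  A change of frame \<open>g\<close> turns \<open>N\<close> into \<open>det g \<cdot> g\<^sup>-\<^sup>1 N g\<^sup>-\<^sup>T\<close>,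
  and since the determinant can be absorbed into a scalar multiple of \<open>g\<close>, the structure
  matrix is well defined precisely up to congruence. So one classifies complex bilinear forms in
  three variables by splitting off the radical of the skew-symmetric part. The annihilator
  components of the products are then absorbed into the frame, except on the kernel of \<open>N\<close>,
  where only their linear dependence matters; as the annihilator has codimension 3, the kernel of
  the full product \<open>\<Lambda>\<^sup>2 \<rightarrow> A\<close> is at most one-dimensional.

  Conversely, the normal forms are told apart by the ranks of \<open>s N + t N\<^sup>T\<close> for suitable
  \<open>s, t\<close>. Members of the list with the same structure matrix are separated by whether the
  kernel of the full product is trivial, and the algebra 9 with parameter 0 is separated from the
  algebra 10 by whether some \<open>[[x, y], z] \<noteq> 0\<close> lies in the annihilator.
\<close>

section \<open>Congruence of 3 by 3 matrices\<close>

text \<open>Codimension three matters twice. Let W be A modulo its annihilator. The product induces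
  a map from the bivectors of W to W, and in dimension three bivectors are the dual of W twisted by
  the determinant, so this map is a bilinear form: hence congruence. Moreover every bivector is
  decomposable. If the full product killed two independent bivectors, their planes would share a
  vector x, and x would bracket to zero with everything; this is why its kernel is at most a line.

  Shifting a frame vector by the annihilator changes no bracket, only the expression of the brackets
  in the frame. The annihilator components are therefore a linear map on bivectors that counts only
  modulo maps factoring through N, that is, through its restriction to the kernel of N. A kernel of
  dimension 0 yields one algebra, of dimension 1 two algebras, zero or nonzero restriction.

  The parameter is a ratio at which the pencil of N and its transpose drops in rank. The two
  matrices enter symmetrically, so \<alpha> and 1/\<alpha> cannot be distinguished, and
  \<open>C_gt1\<close> together with 1 contains one element of each such pair.\<close>

definition mat3 ::
  "'a::zero \<Rightarrow> 'a \<Rightarrow> 'a \<Rightarrow> 'a \<Rightarrow> 'a \<Rightarrow> 'a \<Rightarrow> 'a \<Rightarrow> 'a \<Rightarrow> 'a \<Rightarrow> 'a^3^3" where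
  "mat3 a b c d e f g h i = vector [vector [a, b, c], vector [d, e, f], vector [g, h, i]]"

lemma mat3_nth [simp]:
  "mat3 a b c d e f g h i $ 1 $ 1 = a" "mat3 a b c d e f g h i $ 1 $ 2 = b"
  "mat3 a b c d e f g h i $ 1 $ 3 = c" "mat3 a b c d e f g h i $ 2 $ 1 = d"
  "mat3 a b c d e f g h i $ 2 $ 2 = e" "mat3 a b c d e f g h i $ 2 $ 3 = f"
  "mat3 a b c d e f g h i $ 3 $ 1 = g" "mat3 a b c d e f g h i $ 3 $ 2 = h"
  "mat3 a b c d e f g h i $ 3 $ 3 = i"
  by (simp_all add: mat3_def)

lemma mat3_cases:
  obtains a b c d e f g h i where "(M :: 'a::zero^3^3) = mat3 a b c d e f g h i"
proof
  show "M = mat3 (M$1$1) (M$1$2) (M$1$3) (M$2$1) (M$2$2) (M$2$3) (M$3$1) (M$3$2) (M$3$3)"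
    by (simp add: vec_eq_iff forall_3)
qed

lemma mat3_eq_iff:
  "mat3 a b c d e f g h i = mat3 a' b' c' d' e' f' g' h' i' \<longleftrightarrow>
    a = a' \<and> b = b' \<and> c = c' \<and> d = d' \<and> e = e' \<and> f = f' \<and> g = g' \<and> h = h' \<and> i = i'"
  by (auto simp: vec_eq_iff forall_3)

lemma mat3_mult:
  "mat3 a b c d e f g h i ** mat3 a' b' c' d' e' f' g' h' i' =
   mat3 (a*a' + b*d' + c*g') (a*b' + b*e' + c*h') (a*c' + b*f' + c*i')
        (d*a' + e*d' + f*g') (d*b' + e*e' + f*h') (d*c' + e*f' + f*i')
        (g*a' + h*d' + i*g') (g*b' + h*e' + i*h') (g*c' + h*f' + i*i')"
  by (simp add: vec_eq_iff forall_3 matrix_matrix_mult_def sum_3)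

lemma transpose_mat3: "transpose (mat3 a b c d e f g h i) = mat3 a d g b e h c f i"
  by (simp add: vec_eq_iff forall_3 transpose_def)

lemma det_mat3:
  "det (mat3 a b c d e f g h i) = (a*e*i + b*f*g + c*d*h - a*f*h - b*d*i - c*e*g :: 'a::comm_ring_1)"
  by (simp add: det_3)

lemma zero_mat3: "0 = mat3 0 0 0 0 0 0 0 0 0"
  by (simp add: vec_eq_iff forall_3)

lemma mat_1_mat3: "mat 1 = mat3 1 0 0 0 1 0 0 0 1"
  by (simp add: vec_eq_iff forall_3 mat_def)

text \<open>The rows of \<open>h\<close> are the new basis vectors: the entries of the result are
  the values of the bilinear form \<open>M\<close> on pairs of rows. The explicit witnesses of
  congruence below are to be read in this way.\<close>

definition matrix_congruent :: "'a::comm_ring_1^'n^'n \<Rightarrow> 'a^'n^'n \<Rightarrow> bool" where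
  "matrix_congruent M N \<longleftrightarrow> (\<exists>h. det h \<noteq> 0 \<and> h ** M ** transpose h = N)"

lemma matrix_congruentI: "det h \<noteq> 0 \<Longrightarrow> h ** M ** transpose h = N \<Longrightarrow> matrix_congruent M N"
  unfolding matrix_congruent_def by blast

lemma matrix_congruent_refl: "matrix_congruent M M"
  by (rule matrix_congruentI[of "mat 1"]) (simp_all add: transpose_mat)

lemma matrix_congruent_trans:
  fixes M :: "'a::idom^'n^'n"
  assumes "matrix_congruent M N" "matrix_congruent N P"
  shows "matrix_congruent M P"
proof -
  from assms obtain h k where h: "det h \<noteq> 0" "h ** M ** transpose h = N"
    and k: "det k \<noteq> 0" "k ** N ** transpose k = P"
    unfolding matrix_congruent_def by blast
  show ?thesis
    by (rule matrix_congruentI[of "k ** h"])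
      (use h k in \<open>auto simp: det_mul matrix_transpose_mul matrix_mul_assoc\<close>)
qed

lemmas mat3_simps = mat3_mult transpose_mat3 det_mat3 mat3_eq_iff

section \<open>The parameter set as a choice from each pair of inverse numbers\<close>

text \<open>Off the unit circle one of the two moduli exceeds 1. On the circle inversion negates the
  argument, except at -1, which is its own inverse and has argument pi.\<close>

lemma C_gt1_or_inverse:
  assumes "\<alpha> \<noteq> 0" "\<alpha> \<noteq> 1"
  shows "\<alpha> \<in> C_gt1 \<or> inverse \<alpha> \<in> C_gt1"
proof -
  consider "cmod \<alpha> > 1" | "cmod \<alpha> < 1" | "cmod \<alpha> = 1" by linarith
  then show ?thesis
  proof cases
    case 1
    then show ?thesis using assms by (simp add: C_gt1_def)
  next
    case 2
    then have "cmod (inverse \<alpha>) > 1"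
      using assms by (simp add: norm_inverse one_less_inverse)
    then show ?thesis using assms by (simp add: C_gt1_def)
  next
    case 3
    have "Arg \<alpha> \<noteq> 0"
    proof
      assume "Arg \<alpha> = 0"
      then have "\<alpha> = of_real (cmod \<alpha>)"
        using assms(1) by (metis Arg_eq_0 complex_is_Real_iff norm_of_real of_real_Re abs_of_nonneg)
      with 3 assms show False by simp
    qed
    then have "0 < Arg \<alpha> \<or> 0 < Arg (inverse \<alpha>) \<or> (\<alpha> \<in> \<real> \<and> Arg \<alpha> < 0)"
      by (auto simp: Arg_inverse)
    moreover have "\<not> (\<alpha> \<in> \<real> \<and> Arg \<alpha> < 0)"
      by (auto simp: Arg_real split: if_splits)
    ultimately show ?thesis
      using 3 assms Arg_bounded by (auto simp: C_gt1_def norm_inverse)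
  qed
qed

text \<open>Both moduli are at least 1 and have product 1, so both are 1. Two positive arguments
  cannot be opposite, which leaves the real numbers, where inverses of modulus 1 coincide.\<close>

lemma C_gt1_mult_eq_1:
  assumes "\<alpha> \<in> C_gt1 \<union> {1}" "\<beta> \<in> C_gt1 \<union> {1}" "\<alpha> * \<beta> = 1"
  shows "\<alpha> = \<beta>"
proof -
  have nz: "\<alpha> \<noteq> 0" and \<beta>: "\<beta> = inverse \<alpha>"
    using assms(3) inverse_unique by auto
  have norm: "cmod \<alpha> * cmod \<beta> = 1"
    using assms(3) by (metis norm_mult norm_one)
  have ge: "cmod \<alpha> \<ge> 1" "cmod \<beta> \<ge> 1"
    using assms(1,2) by (auto simp: C_gt1_def)
  have "cmod \<alpha> \<le> cmod \<alpha> * cmod \<beta>"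
    using ge mult_left_mono[of 1 "cmod \<beta>" "cmod \<alpha>"] by simp
  with norm ge have "cmod \<alpha> = 1" by simp
  with norm have "cmod \<beta> = 1" by simp
  consider "\<alpha> = 1" | "\<beta> = 1" | "0 < Arg \<alpha>" "0 < Arg \<beta>"
    using assms(1,2) \<open>cmod \<alpha> = 1\<close> \<open>cmod \<beta> = 1\<close> by (auto simp: C_gt1_def)
  then show ?thesis
  proof cases
    case 3
    then have "\<alpha> \<in> \<real>"
      unfolding \<beta> by (auto simp: Arg_inverse split: if_splits)
    then obtain r where "\<alpha> = of_real r" by (auto elim: Reals_cases)
    with \<open>cmod \<alpha> = 1\<close> have "r = 1 \<or> r = -1" by auto
    with \<open>\<alpha> = of_real r\<close> have "\<alpha> = 1 \<or> \<alpha> = -1" by auto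
    then show ?thesis using \<beta> by auto
  qed (use assms(3) in auto)
qed

lemma zero_notin_C_gt1: "0 \<notin> C_gt1" and one_notin_C_gt1: "1 \<notin> C_gt1"
  by (auto simp: C_gt1_def)

lemma minus_one_in_C_gt1: "-1 \<in> C_gt1"
proof -
  have "-1 \<in> C_gt1 \<or> inverse (-1) \<in> C_gt1"
    by (rule C_gt1_or_inverse) auto
  then show ?thesis by simp
qed

section \<open>Normal forms of complex bilinear forms in three variables\<close>

lemma complex_quadratic_root:
  assumes "(a::complex) \<noteq> 0"
  obtains x where "a * x^2 + b * x + c = 0"
proof
  let ?s = "csqrt (b^2 - 4 * a * c)"
  have s: "?s^2 = b^2 - 4*a*c" by simp
  have "4 * a * (a * ((?s - b) / (2*a))^2 + b * ((?s - b) / (2*a)) + c) = ?s^2 - (b^2 - 4*a*c)"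
    using assms by (simp add: field_simps power2_eq_square)
  also have "\<dots> = 0" using s by simp
  finally show "a * ((?s - b) / (2*a))^2 + b * ((?s - b) / (2*a)) + c = 0"
    using assms by simp
qed

text \<open>An isotropic vector of the plane is taken as first basis vector.\<close>

lemma matrix_congruent_plane:
  fixes b d :: complex
  assumes "b \<noteq> d"
  shows "(\<exists>\<alpha>\<in>C_gt1 \<union> {0}. \<alpha> \<noteq> -1 \<and>
            matrix_congruent (mat3 a b 0 d e 0 0 0 g) (mat3 0 (-1) 0 \<alpha> 0 0 0 0 g)) \<or>
         matrix_congruent (mat3 a b 0 d e 0 0 0 g) (mat3 0 (-1) 0 1 0 0 0 0 g) \<or>
         matrix_congruent (mat3 a b 0 d e 0 0 0 g) (mat3 0 (-1) 0 1 (-1) 0 0 0 g)"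
proof -
  have "\<exists>b' d' e'. b' \<noteq> d' \<and> matrix_congruent (mat3 a b 0 d e 0 0 0 g) (mat3 0 b' 0 d' e' 0 0 0 g)"
  proof (cases "a = 0")
    case True
    then show ?thesis using assms matrix_congruent_refl by blast
  next
    case False
    then obtain x where x: "a * x^2 + (b + d) * x + e = 0"
      by (rule complex_quadratic_root)
    then have x': "(x * a + d) * x + (x * b + e) = 0"
      by algebra
    have "matrix_congruent (mat3 a b 0 d e 0 0 0 g) (mat3 0 (x*a + d) 0 (a*x + b) a 0 0 0 g)"
      by (rule matrix_congruentI[of "mat3 x 1 0 1 0 0 0 0 1"]) (simp_all add: mat3_simps x')
    then show ?thesis using assms by (metis add_left_cancel mult.commute)
  qed
  then obtain b' d' e' where bd: "b' \<noteq> d'"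
    and 1: "matrix_congruent (mat3 a b 0 d e 0 0 0 g) (mat3 0 b' 0 d' e' 0 0 0 g)" by blast
  show ?thesis
  proof (cases "b' + d' = 0")
    \<comment> \<open>The first vector is isotropic and the off-diagonal part is purely
      skew-symmetric, so \<open>e'\<close> is the whole symmetric part of the plane. No shear by the
      first vector alters it; it can only be rescaled.\<close>
    case True
    then have b': "b' = - d'" by (simp add: eq_neg_iff_add_eq_0)
    with bd have d': "d' \<noteq> 0" by auto
    show ?thesis
    proof (cases "e' = 0")
      case True
      have "matrix_congruent (mat3 0 b' 0 d' e' 0 0 0 g) (mat3 0 (-1) 0 1 0 0 0 0 g)"
        by (rule matrix_congruentI[of "mat3 (1/d') 0 0 0 1 0 0 0 1"])
          (use True d' b' in \<open>simp_all add: mat3_simps\<close>)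
      then show ?thesis using matrix_congruent_trans[OF 1] by blast
    next
      case False
      define s where "s = csqrt (-1/e')"
      have s: "s * (s * e') = -1"
        using False by (simp add: s_def mult.assoc[symmetric] power2_eq_square[symmetric])
      then have s0: "s \<noteq> 0" by auto
      have "matrix_congruent (mat3 0 b' 0 d' e' 0 0 0 g) (mat3 0 (-1) 0 1 (-1) 0 0 0 g)"
        by (rule matrix_congruentI[of "mat3 (1/(s*d')) 0 0 0 s 0 0 0 1"])
          (use False s s0 d' b' in \<open>simp_all add: mat3_simps ac_simps\<close>)
      then show ?thesis using matrix_congruent_trans[OF 1] by blast
    qed
  next
    case False
    \<comment> \<open>Adding \<open>t\<close> times the isotropic vector to the second one changes
      \<open>e'\<close> by \<open>t * (b' + d')\<close>, so outside the skew case \<open>e'\<close>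
      can be cleared.\<close>
    define t where "t = - e' / (b' + d')"
    have t: "t * (b' + d') + e' = 0" using False by (simp add: t_def)
    have 2: "matrix_congruent (mat3 0 b' 0 d' e' 0 0 0 g) (mat3 0 b' 0 d' 0 0 0 0 g)"
      by (rule matrix_congruentI[of "mat3 1 0 0 t 1 0 0 0 1"])
        (use t in \<open>simp_all add: mat3_simps algebra_simps\<close>)
    have "\<exists>\<alpha>\<in>C_gt1 \<union> {0}. \<alpha> \<noteq> -1 \<and>
            matrix_congruent (mat3 0 b' 0 d' 0 0 0 0 g) (mat3 0 (-1) 0 \<alpha> 0 0 0 0 g)"
    proof (cases "b' = 0 \<or> d' = 0")
      case True
      then show ?thesis
      proof
        assume "b' = 0"
        then have "matrix_congruent (mat3 0 b' 0 d' 0 0 0 0 g) (mat3 0 (-1) 0 0 0 0 0 0 g)"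
          by (intro matrix_congruentI[of "mat3 0 (-1/d') 0 1 0 0 0 0 1"])
            (use bd in \<open>simp_all add: mat3_simps\<close>)
        then show ?thesis by force
      next
        assume "d' = 0"
        then have "matrix_congruent (mat3 0 b' 0 d' 0 0 0 0 g) (mat3 0 (-1) 0 0 0 0 0 0 g)"
          by (intro matrix_congruentI[of "mat3 (-1/b') 0 0 0 1 0 0 0 1"])
            (use bd in \<open>simp_all add: mat3_simps\<close>)
        then show ?thesis by force
      qed
    next
      case nz: False
      \<comment> \<open>Normalising the entry \<open>b'\<close> to -1 gives the parameter
        \<open>\<alpha>\<close>; exchanging the two vectors first gives its inverse. One of them is
        in \<open>C_gt1\<close>. The values 1 and -1 are excluded because the plane is neither
        skew-symmetric nor symmetric.\<close>
      define \<alpha> where "\<alpha> = - d' / b'"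
      have ne: "\<alpha> \<noteq> 0" "\<alpha> \<noteq> 1" "\<alpha> \<noteq> -1" "inverse \<alpha> \<noteq> -1"
        using bd False nz by (auto simp: \<alpha>_def field_simps)
      have "matrix_congruent (mat3 0 b' 0 d' 0 0 0 0 g) (mat3 0 (-1) 0 \<alpha> 0 0 0 0 g)"
        by (rule matrix_congruentI[of "mat3 (-1/b') 0 0 0 1 0 0 0 1"])
          (use nz in \<open>simp_all add: mat3_simps \<alpha>_def\<close>)
      moreover have "matrix_congruent (mat3 0 b' 0 d' 0 0 0 0 g) (mat3 0 (-1) 0 (inverse \<alpha>) 0 0 0 0 g)"
        by (rule matrix_congruentI[of "mat3 0 (-1/d') 0 1 0 0 0 0 1"])
          (use nz in \<open>simp_all add: mat3_simps \<alpha>_def\<close>)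
      ultimately show ?thesis
        using C_gt1_or_inverse[OF ne(1,2)] ne(3,4) by blast
    qed
    then show ?thesis using matrix_congruent_trans[OF 1 matrix_congruent_trans[OF 2]] by blast
  qed
qed

text \<open>
  The basis is changed so that its last vector spans the radical of the skew-symmetric part.
\<close>

lemma matrix_congruent_skew_radical:
  fixes N :: "complex^3^3"
  assumes "transpose N \<noteq> N"
  obtains a b c d e f g where "b \<noteq> d" "matrix_congruent N (mat3 a b c d e f c f g)"
proof -
  note * = that
  obtain n11 n12 n13 n21 n22 n23 n31 n32 n33
    where N: "N = mat3 n11 n12 n13 n21 n22 n23 n31 n32 n33" by (rule mat3_cases)
  \<comment> \<open>The form \<open>N - transpose N\<close> sends x, y to the scalar product of
    (\<open>t1\<close>, \<open>t2\<close>, \<open>t3\<close>) with x \<times> y. Its radical is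
    therefore spanned by this vector, and its value on the first two rows of \<open>h\<close> is
    \<open>det h\<close>.\<close>
  define t1 t2 t3 where t: "t1 = n23 - n32" "t2 = n31 - n13" "t3 = n12 - n21"
  have core: ?thesis if "h = mat3 x1 x2 x3 y1 y2 y3 t1 t2 t3" "det h \<noteq> 0"
    for h x1 x2 x3 y1 y2 y3
  proof -
    obtain a b c d e f c' f' g where
      M: "h ** N ** transpose h = mat3 a b c d e f c' f' g" by (rule mat3_cases)
    have ne: "b - d = det h"
      using M unfolding that(1) N t
      by (auto simp: mat3_simps) (simp add: algebra_simps)
    moreover have cf: "c' = c" "f' = f"
      using M unfolding that(1) N t by (auto simp: mat3_simps) (simp_all add: algebra_simps)
    ultimately show ?thesis
      using that(2) M matrix_congruentI[of h N] by (intro *[of b d a c e f g]) auto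
  qed
  have "t1 \<noteq> 0 \<or> t2 \<noteq> 0 \<or> t3 \<noteq> 0"
    using assms by (auto simp: N transpose_mat3 mat3_eq_iff t)
  then show thesis
    using core[of _ 1 0 0 0 1 0, OF refl] core[of _ 0 0 1 1 0 0, OF refl]
      core[of _ 0 1 0 0 0 1, OF refl]
    by (auto simp: det_mat3)
qed

text \<open>One step of orthogonalisation. A nonzero symmetric form has a vector of nonzero square:
  a basis vector or, by polarisation, a sum of two of them. Over the complex numbers its square is
  scaled to 1, and the other vectors are made orthogonal to it.\<close>

lemma matrix_congruent_symmetric_pivot:
  fixes N :: "complex^3^3"
  assumes "transpose N = N" "N \<noteq> 0"
  obtains a b c where "matrix_congruent N (mat3 1 0 0 0 a b 0 b c)"
proof -
  obtain n11 n12 n13 n21 n22 n23 n31 n32 n33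
    where N: "N = mat3 n11 n12 n13 n21 n22 n23 n31 n32 n33" by (rule mat3_cases)
  have sym: "n21 = n12" "n31 = n13" "n32 = n23"
    using assms(1)[unfolded N transpose_mat3 mat3_eq_iff] by blast+
  have "\<exists>a b c e f g. a \<noteq> 0 \<and> matrix_congruent N (mat3 a b c b e f c f g)"
  proof -
    consider "n11 \<noteq> 0" | "n22 \<noteq> 0" | "n33 \<noteq> 0"
      | "n11 = 0" "n22 = 0" "n33 = 0" "n12 \<noteq> 0" | "n11 = 0" "n22 = 0" "n33 = 0" "n13 \<noteq> 0"
      | "n11 = 0" "n22 = 0" "n33 = 0" "n23 \<noteq> 0"
      using assms(2) by (auto simp: N zero_mat3 mat3_eq_iff sym)
    then show ?thesis
    proof cases
      case 1
      then show ?thesis using matrix_congruent_refl[of N] unfolding N sym by blast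
    next
      case 2
      have "matrix_congruent N (mat3 n22 n12 n23 n12 n11 n13 n23 n13 n33)"
        by (rule matrix_congruentI[of "mat3 0 1 0 1 0 0 0 0 1"]) (simp_all add: mat3_simps N sym)
      then show ?thesis using 2 by blast
    next
      case 3
      have "matrix_congruent N (mat3 n33 n23 n13 n23 n22 n12 n13 n12 n11)"
        by (rule matrix_congruentI[of "mat3 0 0 1 0 1 0 1 0 0"]) (simp_all add: mat3_simps N sym)
      then show ?thesis using 3 by blast
    next
      case 4
      have "matrix_congruent N (mat3 (2*n12) n12 (n13+n23) n12 0 n23 (n13+n23) n23 0)"
        by (rule matrix_congruentI[of "mat3 1 1 0 0 1 0 0 0 1"]) (simp_all add: mat3_simps N sym 4)
      then show ?thesis using 4(4) by (metis mult_eq_0_iff zero_neq_numeral)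
    next
      case 5
      have "matrix_congruent N (mat3 (2*n13) (n12+n23) n13 (n12+n23) 0 n23 n13 n23 0)"
        by (rule matrix_congruentI[of "mat3 1 0 1 0 1 0 0 0 1"]) (simp_all add: mat3_simps N sym 5)
      then show ?thesis using 5(4) by (metis mult_eq_0_iff zero_neq_numeral)
    next
      case 6
      have "matrix_congruent N (mat3 (2*n23) n23 (n12+n13) n23 0 n13 (n12+n13) n13 0)"
        by (rule matrix_congruentI[of "mat3 0 1 1 0 0 1 1 0 0"]) (simp_all add: mat3_simps N sym 6)
      then show ?thesis using 6(4) by (metis mult_eq_0_iff zero_neq_numeral)
    qed
  qed
  then obtain a b c e f g where a: "a \<noteq> 0" and 1: "matrix_congruent N (mat3 a b c b e f c f g)"
    by blast
  define s where "s = csqrt a"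
  have s: "s * s = a" "s \<noteq> 0"
    using a by (auto simp: s_def power2_eq_square[symmetric])
  have "matrix_congruent (mat3 a b c b e f c f g)
          (mat3 1 0 0 0 (e - b*b/a) (f - b*c/a) 0 (f - b*c/a) (g - c*c/a))"
    by (rule matrix_congruentI[of "mat3 (1/s) 0 0 (-b/a) 1 0 (-c/a) 0 1"])
      (use s a in \<open>simp_all add: mat3_simps s(1)[symmetric]\<close>)
  then show thesis
    using that matrix_congruent_trans[OF 1] by blast
qed

text \<open>Over the complex numbers the rank classifies symmetric forms. The representative of rank
  two is not diagonal because it has to match the structure matrix of algebra 2 with parameter
  -1.\<close>

lemma matrix_congruent_symmetric:
  fixes N :: "complex^3^3"
  assumes "transpose N = N"
  shows "N = 0 \<or> matrix_congruent N (mat3 1 0 0 0 0 0 0 0 0) \<or>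
    matrix_congruent N (mat3 0 (-1) 0 (-1) (-1) 0 0 0 0) \<or> matrix_congruent N (mat 1)"
proof (cases "N = 0")
  case False
  with assms obtain a b c where 1: "matrix_congruent N (mat3 1 0 0 0 a b 0 b c)"
    by (rule matrix_congruent_symmetric_pivot)
  have "(a = 0 \<and> b = 0 \<and> c = 0) \<or>
    (\<exists>a' b' c'. a' \<noteq> 0 \<and> matrix_congruent (mat3 1 0 0 0 a b 0 b c) (mat3 1 0 0 0 a' b' 0 b' c'))"
  proof -
    consider "a \<noteq> 0" | "c \<noteq> 0" | "a = 0" "c = 0" "b \<noteq> 0" | "a = 0" "b = 0" "c = 0"
      by blast
    then show ?thesis
    proof cases
      case 1
      then show ?thesis using matrix_congruent_refl by blast
    next
      case 2
      have "matrix_congruent (mat3 1 0 0 0 a b 0 b c) (mat3 1 0 0 0 c b 0 b a)"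
        by (rule matrix_congruentI[of "mat3 1 0 0 0 0 1 0 1 0"]) (simp_all add: mat3_simps)
      then show ?thesis using 2 by blast
    next
      case 3
      have "matrix_congruent (mat3 1 0 0 0 a b 0 b c) (mat3 1 0 0 0 (2*b) b 0 b 0)"
        by (rule matrix_congruentI[of "mat3 1 0 0 0 1 1 0 0 1"]) (simp_all add: mat3_simps 3)
      then show ?thesis using 3(3) by (metis mult_eq_0_iff zero_neq_numeral)
    qed blast
  qed
  then show ?thesis
  proof
    assume "a = 0 \<and> b = 0 \<and> c = 0"
    then show ?thesis using 1 by simp
  next
    assume "\<exists>a' b' c'. a' \<noteq> 0 \<and> matrix_congruent (mat3 1 0 0 0 a b 0 b c) (mat3 1 0 0 0 a' b' 0 b' c')"
    then obtain a' b' c' where a': "a' \<noteq> 0"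
      and 2: "matrix_congruent (mat3 1 0 0 0 a b 0 b c) (mat3 1 0 0 0 a' b' 0 b' c')" by blast
    define s where "s = csqrt a'"
    have s: "s * s = a'" "s \<noteq> 0"
      using a' by (auto simp: s_def power2_eq_square[symmetric])
    define d where "d = c' - b'*b'/a'"
    have 3: "matrix_congruent (mat3 1 0 0 0 a' b' 0 b' c') (mat3 1 0 0 0 1 0 0 0 d)"
      by (rule matrix_congruentI[of "mat3 1 0 0 0 (1/s) 0 0 (-b'/a') 1"])
        (use s a' in \<open>simp_all add: mat3_simps s(1)[symmetric] d_def\<close>)
    note 123 = matrix_congruent_trans[OF matrix_congruent_trans[OF 1 2] 3]
    show ?thesis
    proof (cases "d = 0")
      case True
      \<comment> \<open>The vector (1, \<open>\<i>\<close>, 0) is isotropic for the sum of two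
        squares and takes the role of first basis vector.\<close>
      have "matrix_congruent (mat3 1 0 0 0 1 0 0 0 d) (mat3 0 (-1) 0 (-1) (-1) 0 0 0 0)"
        by (rule matrix_congruentI[of "mat3 1 \<i> 0 0 \<i> 0 0 0 1"]) (simp_all add: mat3_simps True)
      then show ?thesis using matrix_congruent_trans[OF 123] by blast
    next
      case False
      define t where "t = csqrt d"
      have t: "t * t = d" "t \<noteq> 0"
        using False by (auto simp: t_def power2_eq_square[symmetric])
      have "matrix_congruent (mat3 1 0 0 0 1 0 0 0 d) (mat 1)"
        by (rule matrix_congruentI[of "mat3 1 0 0 0 1 0 0 0 (1/t)"])
          (use t in \<open>simp_all add: mat3_simps mat_1_mat3 t(1)[symmetric]\<close>)
      then show ?thesis using matrix_congruent_trans[OF 123] by blast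
    qed
  qed
qed simp

text \<open>The third vector spans the radical of the skew-symmetric part, so its row and column
  agree, and as \<open>g\<close> is nonzero one projection clears both. What remains is an
  orthogonal sum of a plane and a line. The table of algebra 4 is not adapted to this splitting,
  which is why further witnesses are needed.\<close>

lemma matrix_congruent_anisotropic_radical:
  fixes b d g :: complex
  assumes "b \<noteq> d" "g \<noteq> 0"
  shows "(\<exists>\<alpha>\<in>C_gt1 \<union> {0, 1}. matrix_congruent (mat3 a b c d e f c f g) (mat3 0 (-1) 0 \<alpha> 0 0 0 (-1) 1)) \<or>
         matrix_congruent (mat3 a b c d e f c f g) (mat3 0 (-1) 0 1 0 0 0 0 1)"
    (is "(\<exists>\<alpha>\<in>_. matrix_congruent ?N (?N4 \<alpha>)) \<or> matrix_congruent ?N ?N6")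
proof -
  define s where "s = csqrt g"
  have s: "s * s = g" "s \<noteq> 0"
    using assms(2) by (auto simp: s_def power2_eq_square[symmetric])
  have 1: "matrix_congruent ?N (mat3 (a - c*c/g) (b - c*f/g) 0 (d - c*f/g) (e - f*f/g) 0 0 0 1)"
    by (rule matrix_congruentI[of "mat3 1 0 (-c/g) 0 1 (-f/g) 0 0 (1/s)"])
      (use s assms(2) in \<open>simp_all add: mat3_simps s(1)[symmetric]\<close>)
  have "b - c*f/g \<noteq> d - c*f/g" using assms(1) by simp
  from matrix_congruent_plane[OF this, of "a - c*c/g" "e - f*f/g" 1]
  consider \<alpha> where "\<alpha> \<in> C_gt1 \<union> {0}" "\<alpha> \<noteq> -1" "matrix_congruent ?N (mat3 0 (-1) 0 \<alpha> 0 0 0 0 1)"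
    | "matrix_congruent ?N ?N6" | "matrix_congruent ?N (mat3 0 (-1) 0 1 (-1) 0 0 0 1)"
    using matrix_congruent_trans[OF 1] by blast
  then show ?thesis
  proof cases
    case (1 \<alpha>)
    \<comment> \<open>In the witness below, the entry \<open>-\<alpha>*c\<close> makes the (2,3)
      entry of the result vanish; then the (3,2) entry -1 forces \<open>c\<close>, and the (2,2)
      entry 0 forces \<open>x\<close>. Solvability requires that \<open>\<alpha>\<close> is neither
      -1 nor 1.\<close>
    define c where "c = 1 / (1 + \<alpha>)"
    define x where "x = (\<alpha> * c)^2 / (1 - \<alpha>)"
    have nz: "1 + \<alpha> \<noteq> 0" "1 - \<alpha> \<noteq> 0"
      using 1(1,2) one_notin_C_gt1 by (auto simp: add_eq_0_iff)
    have c: "\<alpha> * c = 1 - c"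
      using nz by (simp add: c_def field_simps)
    have x: "x * (1 - \<alpha>) = (\<alpha> * c)^2"
      using nz by (simp add: x_def)
    have "matrix_congruent (mat3 0 (-1) 0 \<alpha> 0 0 0 0 1) (?N4 \<alpha>)"
    proof (rule matrix_congruentI[of "mat3 1 0 0 x 1 (-\<alpha>*c) c 0 1"])
      show "mat3 1 0 0 x 1 (-\<alpha>*c) c 0 1 ** mat3 0 (-1) 0 \<alpha> 0 0 0 0 1 **
          transpose (mat3 1 0 0 x 1 (-\<alpha>*c) c 0 1) = ?N4 \<alpha>"
        using c x by (simp add: mat3_simps) algebra
    qed (simp add: det_mat3)
    then show ?thesis using 1 matrix_congruent_trans by blast
  next
    case 2
    then show ?thesis by blast
  next
    case 3
    have "matrix_congruent (mat3 0 (-1) 0 1 (-1) 0 0 0 1) (?N4 1)"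
      by (rule matrix_congruentI[of "mat3 2 0 0 0 (1/2) (-1/2) 1 0 1"]) (simp_all add: mat3_simps)
    then show ?thesis using matrix_congruent_trans[OF 3] by blast
  qed
qed

text \<open>The form lives on a plane. For \<alpha> different from 1 a shear of the second vector
  produces the diagonal entry -1 that algebra 2 demands. At \<alpha> = 1 shears have no effect, and
  the presence of this entry separates algebra 2 from algebra 1.\<close>

lemma matrix_congruent_radical_kernel:
  fixes b d :: complex
  assumes "b \<noteq> d"
  shows "(\<exists>\<alpha>\<in>C_gt1 \<union> {0, 1}. matrix_congruent (mat3 a b 0 d e 0 0 0 0) (mat3 0 (-1) 0 \<alpha> (-1) 0 0 0 0)) \<or>
         matrix_congruent (mat3 a b 0 d e 0 0 0 0) (mat3 0 (-1) 0 1 0 0 0 0 0)"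
    (is "(\<exists>\<alpha>\<in>_. matrix_congruent ?N (?N2 \<alpha>)) \<or> matrix_congruent ?N ?N1")
proof -
  from matrix_congruent_plane[OF assms, of a e 0]
  consider \<alpha> where "\<alpha> \<in> C_gt1 \<union> {0}" "matrix_congruent ?N (mat3 0 (-1) 0 \<alpha> 0 0 0 0 0)"
    | "matrix_congruent ?N ?N1" | "matrix_congruent ?N (?N2 1)"
    by blast
  then show ?thesis
  proof cases
    case (1 \<alpha>)
    then have "\<alpha> \<noteq> 1" using one_notin_C_gt1 by auto
    then have "\<alpha> / (1 - \<alpha>) - 1 / (1 - \<alpha>) = -1"
      by (simp add: diff_divide_distrib[symmetric] divide_eq_minus_1_iff)
    then have "matrix_congruent (mat3 0 (-1) 0 \<alpha> 0 0 0 0 0) (?N2 \<alpha>)"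
      by (intro matrix_congruentI[of "mat3 1 0 0 (1/(1-\<alpha>)) 1 0 0 0 1"])
        (simp_all add: mat3_simps)
    then show ?thesis using 1 matrix_congruent_trans by blast
  qed blast+
qed

text \<open>The radical vector is isotropic but pairs nontrivially with the plane. It therefore
  serves to clear everything except a skew entry and the square of one vector orthogonal to it; that
  square is zero or can be normalised. The second outcome is algebra 4 with parameter -1, the value
  that cannot arise from a nonsymmetric plane in the anisotropic case.\<close>

lemma matrix_congruent_isotropic_radical:
  fixes b d :: complex
  assumes "b \<noteq> d" "c \<noteq> 0 \<or> f \<noteq> 0"
  shows "matrix_congruent (mat3 a b c d e f c f 0) (mat3 0 0 1 1 0 0 0 0 0) \<or>
         matrix_congruent (mat3 a b c d e f c f 0) (mat3 0 (-1) 0 (-1) 0 0 0 (-1) 1)"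
    (is "matrix_congruent ?N ?N5 \<or> matrix_congruent ?N ?N4")
proof -
  have "\<exists>a' b' d' e'. b' \<noteq> d' \<and> matrix_congruent ?N (mat3 a' b' 1 d' e' 0 1 0 0)"
  proof (cases "c = 0")
    case True
    then have "matrix_congruent ?N (mat3 (e/(f*f)) (d/f) 1 (b/f) a 0 1 0 0)"
      by (intro matrix_congruentI[of "mat3 0 (1/f) 0 1 0 0 0 0 1"])
        (use assms in \<open>simp_all add: mat3_simps\<close>)
    moreover have "d/f \<noteq> b/f" using assms True by auto
    ultimately show ?thesis by blast
  next
    case False
    then have "matrix_congruent ?N (mat3 (a/(c*c)) (b/c - f*a/(c*c)) 1 (d/c - f*a/(c*c))
        (e - (f/c)*b - (f/c)*d + (f/c)*(f/c)*a) 0 1 0 0)"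
      by (intro matrix_congruentI[of "mat3 (1/c) 0 0 (-f/c) 1 0 0 0 1"])
        (simp_all add: mat3_simps field_simps)
    moreover have "b/c - f*a/(c*c) \<noteq> d/c - f*a/(c*c)" using assms False by simp
    ultimately show ?thesis by blast
  qed
  then obtain a' b' d' e' where bd: "b' \<noteq> d'"
    and 1: "matrix_congruent ?N (mat3 a' b' 1 d' e' 0 1 0 0)" by blast
  define x where "x = (b' - d')/2"
  have x: "x \<noteq> 0" using bd by (simp add: x_def)
  \<comment> \<open>The third vector pairs to 1 with the first and to 0 with the second. Subtracting
    suitable multiples of it from both removes the square of the first vector and the symmetric half
    of the entries \<open>b'\<close> and \<open>d'\<close>.\<close>
  have "matrix_congruent (mat3 a' b' 1 d' e' 0 1 0 0) (mat3 0 x 1 (-x) e' 0 1 0 0)"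
    by (rule matrix_congruentI[of "mat3 1 0 (-a'/2) 0 1 (-(b'+d')/2) 0 0 1"])
      (simp_all add: mat3_simps x_def field_simps)
  note 2 = matrix_congruent_trans[OF 1 this]
  show ?thesis
  proof (cases "e' = 0")
    case True
    have "matrix_congruent (mat3 0 x 1 (-x) e' 0 1 0 0) ?N5"
      by (rule matrix_congruentI[of "mat3 1 0 0 0 (-1/(2*x)) (1/2) 0 (1/(2*x)) (1/2)"])
        (use x in \<open>simp_all add: mat3_simps True\<close>)
    then show ?thesis using matrix_congruent_trans[OF 2] by blast
  next
    case False
    define s where "s = csqrt e'"
    have s: "s * s = e'" "s \<noteq> 0"
      using False by (auto simp: s_def power2_eq_square[symmetric])
    have "matrix_congruent (mat3 0 x 1 (-x) e' 0 1 0 0) ?N4"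
      by (rule matrix_congruentI[of "mat3 0 0 (-2*x/s) (s/(2*x)) 0 0 0 (1/s) (-x/s)"])
        (use x s in \<open>simp_all add: mat3_simps s(1)[symmetric]\<close>)
    then show ?thesis using matrix_congruent_trans[OF 2] by blast
  qed
qed

text \<open>\<open>zero\<close>, \<open>square\<close> and \<open>mixed\<close> are the forms of
  rank at most one; they do not occur for an algebra with zero annihilator. \<open>mixed\<close> is
  the form of \<open>N2\<close> at \<alpha> = 0, where its rank drops.\<close>

lemma matrix_congruent_normal_form:
  fixes N :: "complex^3^3"
  obtains (zero) "N = 0"
    | (square) "matrix_congruent N (mat3 1 0 0 0 0 0 0 0 0)"
    | (mixed) "matrix_congruent N (mat3 0 (-1) 0 0 (-1) 0 0 0 0)"
    | (N1) "matrix_congruent N (mat3 0 (-1) 0 1 0 0 0 0 0)"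
    | (N2) \<alpha> where "\<alpha> \<in> C_gt1 \<union> {1}" "matrix_congruent N (mat3 0 (-1) 0 \<alpha> (-1) 0 0 0 0)"
    | (N3) "matrix_congruent N (mat 1)"
    | (N4) \<alpha> where "\<alpha> \<in> C_gt1 \<union> {0, 1}" "matrix_congruent N (mat3 0 (-1) 0 \<alpha> 0 0 0 (-1) 1)"
    | (N5) "matrix_congruent N (mat3 0 0 1 1 0 0 0 0 0)"
    | (N6) "matrix_congruent N (mat3 0 (-1) 0 1 0 0 0 0 1)"
proof (cases "transpose N = N")
  case True
  from matrix_congruent_symmetric[OF True] show thesis
    using zero square N2[of "-1"] N3 minus_one_in_C_gt1 by blast
next
  case False
  then obtain a b c d e f g where ne: "b \<noteq> d" and 1: "matrix_congruent N (mat3 a b c d e f c f g)"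
    by (rule matrix_congruent_skew_radical)
  consider "g \<noteq> 0" | "g = 0" "c = 0" "f = 0" | "g = 0" "c \<noteq> 0 \<or> f \<noteq> 0" by blast
  then show thesis
  proof cases
    case 1
    show ?thesis
      using matrix_congruent_anisotropic_radical[OF ne 1, of a c e f] N4 N6
        matrix_congruent_trans[OF \<open>matrix_congruent N (mat3 a b c d e f c f g)\<close>] by blast
  next
    case 2
    show ?thesis
      using matrix_congruent_radical_kernel[OF ne, of a e] mixed N1 N2
        matrix_congruent_trans[OF \<open>matrix_congruent N (mat3 a b c d e f c f g)\<close>]
      unfolding 2 by blast
  next
    case 3
    show ?thesis
      using matrix_congruent_isotropic_radical[OF ne 3(2), of a e] N4[of "-1"] N5 minus_one_in_C_gt1
        matrix_congruent_trans[OF \<open>matrix_congruent N (mat3 a b c d e f c f g)\<close>]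
      unfolding 3(1) by blast
  qed
qed

section \<open>Frames of an algebra modulo its annihilator\<close>

definition cross3 :: "'a::comm_ring_1^3 \<Rightarrow> 'a^3 \<Rightarrow> 'a^3" where
  "cross3 x y = vector [x$2 * y$3 - x$3 * y$2, x$3 * y$1 - x$1 * y$3, x$1 * y$2 - x$2 * y$1]"

text \<open>The cofactor matrix, which is the action of \<open>g\<close> on bivectors: it sends x
  \<times> y to (g x) \<times> (g y).\<close>

definition cof3 :: "'a::comm_ring_1^3^3 \<Rightarrow> 'a^3^3" where
  "cof3 g = mat3
     (g$2$2 * g$3$3 - g$2$3 * g$3$2) (g$2$3 * g$3$1 - g$2$1 * g$3$3) (g$2$1 * g$3$2 - g$2$2 * g$3$1)
     (g$1$3 * g$3$2 - g$1$2 * g$3$3) (g$1$1 * g$3$3 - g$1$3 * g$3$1) (g$1$2 * g$3$1 - g$1$1 * g$3$2)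
     (g$1$2 * g$2$3 - g$1$3 * g$2$2) (g$1$3 * g$2$1 - g$1$1 * g$2$3) (g$1$1 * g$2$2 - g$1$2 * g$2$1)"

lemma cof3_mult_transpose: "cof3 g ** transpose g = mat (det g)"
  by (simp add: cof3_def vec_eq_iff forall_3 mat_def matrix_matrix_mult_def sum_3 transpose_def
      det_3 algebra_simps)

lemma transpose_cof3_mult: "transpose (cof3 g) ** g = mat (det g)"
  by (simp add: cof3_def vec_eq_iff forall_3 mat_def matrix_matrix_mult_def sum_3 transpose_def
      det_3 algebra_simps)

lemma cof3_transpose_cof3: "cof3 (transpose (cof3 g)) = mat (det g) ** transpose g"
  by (simp add: cof3_def vec_eq_iff forall_3 mat_def matrix_matrix_mult_def sum_3 transpose_def
      det_3 algebra_simps)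

lemma det_mat: "det (mat c :: 'a::comm_ring_1^3^3) = c * c * c"
  by (simp add: det_3 mat_def)

lemma mat_mult_commute: "mat c ** (M :: 'a::comm_ring_1^3^3) = M ** mat c"
  by (simp add: vec_eq_iff forall_3 mat_def matrix_matrix_mult_def sum_3 mult.commute)

context anticommutative_algebra
begin

definition comb :: "(3 \<Rightarrow> 'v) \<Rightarrow> 'k^3 \<Rightarrow> 'v" where
  "comb u x = scale (x$1) (u 1) + scale (x$2) (u 2) + scale (x$3) (u 3)"

text \<open>Each bracket carries the index of the missing vector, with cyclic order fixing the sign,
  so that expanding a bracket in coordinates is a cross product.\<close>

definition derived :: "(3 \<Rightarrow> 'v) \<Rightarrow> 3 \<Rightarrow> 'v" where
  "derived u i = (if i = 1 then br (u 2) (u 3) else if i = 2 then br (u 3) (u 1) else br (u 1) (u 2))"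

abbreviation Ann :: "'v set" where "Ann \<equiv> annihilator V br"

definition frame :: "(3 \<Rightarrow> 'v) \<Rightarrow> bool" where
  "frame u \<longleftrightarrow> range u \<subseteq> V \<and> (\<forall>v\<in>V. \<exists>x. v - comb u x \<in> Ann) \<and> (\<forall>x. comb u x \<in> Ann \<longrightarrow> x = 0)"

definition structure_matrix :: "(3 \<Rightarrow> 'v) \<Rightarrow> 'k^3^3 \<Rightarrow> bool" where
  "structure_matrix u N \<longleftrightarrow> (\<forall>w. comb (derived u) w - comb u (N *v w) \<in> Ann)"

lemma comb_add: "comb u (x + y) = comb u x + comb u y"
  by (simp add: comb_def scale_left_distrib)

lemma comb_diff: "comb u (x - y) = comb u x - comb u y"
  by (simp add: comb_def scale_left_diff_distrib)

lemma comb_0 [simp]: "comb u 0 = 0"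
  by (simp add: comb_def)

lemma comb_scale: "comb u (c *s x) = scale c (comb u x)"
  by (simp add: comb_def scale_right_distrib)

lemma comb_axis [simp]: "comb u (axis i 1) = u i"
  using exhaust_3[of i] by (auto simp: comb_def axis_def)

lemma comb_matrix: "comb (\<lambda>i. comb u (column i g)) x = comb u (g *v x)"
  by (simp add: comb_def column_def matrix_vector_mult_def sum_3 scale_right_distrib
      scale_left_distrib algebra_simps)

lemma V_closed:
  "0 \<in> V" "x \<in> V \<Longrightarrow> y \<in> V \<Longrightarrow> x + y \<in> V" "x \<in> V \<Longrightarrow> y \<in> V \<Longrightarrow> x - y \<in> V"
  "x \<in> V \<Longrightarrow> - x \<in> V" "x \<in> V \<Longrightarrow> scale c x \<in> V"
  using subspace_V by (auto simp: subspace_0 subspace_add subspace_diff subspace_neg subspace_scale)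

lemma comb_in_V: "range u \<subseteq> V \<Longrightarrow> comb u x \<in> V"
  unfolding comb_def by (intro V_closed) auto

lemma br_zero [simp]: "y \<in> V \<Longrightarrow> br 0 y = 0" "y \<in> V \<Longrightarrow> br y 0 = 0"
  using br_scale_left[of y y 0] br_scale_right[of y y 0] by simp_all

lemma br_minus_left: "x \<in> V \<Longrightarrow> y \<in> V \<Longrightarrow> br (- x) y = - br x y"
  using br_scale_left[of x y "-1"] by simp

lemma br_minus_right: "x \<in> V \<Longrightarrow> y \<in> V \<Longrightarrow> br x (- y) = - br x y"
  using br_scale_right[of x y "-1"] by simp

lemma br_self: assumes "x \<in> V" shows "br x x = 0"
proof -
  have "br x x = - br x x" by (rule br_anticomm[OF assms assms])
  then have "scale 2 (br x x) = 0"
    by (metis (no_types) add.right_inverse one_add_one scale_left_distrib scale_one)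
  then show ?thesis using char_not_2 by simp
qed

lemma Ann_subset: "Ann \<subseteq> V"
  by (auto simp: annihilator_def)

lemma Ann_in_V: "a \<in> Ann \<Longrightarrow> a \<in> V"
  by (simp add: annihilator_def)

lemma br_Ann: "a \<in> Ann \<Longrightarrow> v \<in> V \<Longrightarrow> br a v = 0" "a \<in> Ann \<Longrightarrow> v \<in> V \<Longrightarrow> br v a = 0"
  using br_anticomm[of v a] by (auto simp: annihilator_def)

lemma subspace_Ann: "subspace Ann"
  unfolding subspace_def
  by (auto simp: annihilator_def V_closed br_add_left br_scale_left)

lemma Ann_closed:
  "0 \<in> Ann" "x \<in> Ann \<Longrightarrow> y \<in> Ann \<Longrightarrow> x + y \<in> Ann" "x \<in> Ann \<Longrightarrow> y \<in> Ann \<Longrightarrow> x - y \<in> Ann"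
  "x \<in> Ann \<Longrightarrow> - x \<in> Ann" "x \<in> Ann \<Longrightarrow> scale c x \<in> Ann"
  using subspace_Ann by (auto simp: subspace_0 subspace_add subspace_diff subspace_neg subspace_scale)

lemma Ann_diff_commute: "x - y \<in> Ann \<Longrightarrow> y - x \<in> Ann"
  using Ann_closed(4)[of "x - y"] by simp

lemma Ann_diff_trans: "x - y \<in> Ann \<Longrightarrow> y - z \<in> Ann \<Longrightarrow> x - z \<in> Ann"
  using Ann_closed(2)[of "x - y" "y - z"] by simp

lemma br_comb:
  assumes u: "range u \<subseteq> V"
  shows "br (comb u x) (comb u y) = comb (derived u) (cross3 x y)"
proof -
  have [simp]: "u i \<in> V" for i using u by auto
  have [simp]: "br (u i) (u i) = 0" for i by (simp add: br_self)
  have s: "br (u 2) (u 1) = - br (u 1) (u 2)" "br (u 1) (u 3) = - br (u 3) (u 1)"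
    "br (u 3) (u 2) = - br (u 2) (u 3)"
    by (intro br_anticomm; simp)+
  show ?thesis
    by (simp add: comb_def derived_def cross3_def br_add_left br_add_right br_scale_left
        br_scale_right br_closed V_closed s scale_right_distrib scale_left_diff_distrib
        scale_left_distrib mult.commute algebra_simps)
qed

lemma br_cong_Ann:
  assumes "x \<in> V" "y \<in> V" "x' - x \<in> Ann" "y' - y \<in> Ann"
  shows "br x' y' = br x y"
proof -
  define a b where "a = x' - x" and "b = y' - y"
  then have *: "x' = x + a" "y' = y + b" "a \<in> Ann" "b \<in> Ann" "a \<in> V" "b \<in> V"
    using assms Ann_in_V by auto
  then show ?thesis
    using assms(1,2) by (simp add: br_add_left br_add_right V_closed br_Ann)
qed

text \<open>Annihilator components of the new frame disappear inside brackets. Hence the full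
  product, and not only its class modulo the annihilator, transforms by the cofactor matrix
  alone.\<close>

lemma comb_derived_change:
  assumes u: "range u \<subseteq> V" and u': "\<And>i. u' i - comb u (column i g) \<in> Ann"
  shows "comb (derived u') w = comb (derived u) (cof3 g *v w)"
proof -
  have "br (u' i) (u' j) = comb (derived u) (cross3 (column i g) (column j g))" for i j
    using br_cong_Ann[OF _ _ u' u'] comb_in_V[OF u] br_comb[OF u] by metis
  then have "derived u' = (\<lambda>i. comb (derived u) (column i (cof3 g)))"
    by (auto simp: derived_def fun_eq_iff forall_3 intro!: arg_cong[of _ _ "comb (derived u)"])
      (simp_all add: vec_eq_iff forall_3 cross3_def cof3_def column_def)
  then show ?thesis by (simp add: comb_matrix)
qed

lemma comb_in_Ann: "(\<And>i. u i \<in> Ann) \<Longrightarrow> comb u x \<in> Ann"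
  unfolding comb_def by (intro Ann_closed) auto

lemma comb_change:
  assumes u': "\<And>i. u' i - comb u (column i g) \<in> Ann"
  shows "comb u' x - comb u (g *v x) \<in> Ann"
proof -
  have "comb u' x - comb (\<lambda>i. comb u (column i g)) x = comb (\<lambda>i. u' i - comb u (column i g)) x"
    by (simp add: comb_def scale_right_diff_distrib)
  also have "\<dots> \<in> Ann"
    by (intro comb_in_Ann u')
  finally show ?thesis by (simp add: comb_matrix)
qed

lemma frame_in_V: "frame u \<Longrightarrow> u i \<in> V"
  by (auto simp: frame_def)

lemma frame_unique:
  assumes "frame u" "comb u x - comb u y \<in> Ann"
  shows "x = y"
  using assms unfolding frame_def comb_diff[symmetric] by (metis right_minus_eq)

section \<open>Changes of frame and congruence of structure matrices\<close>

text \<open>Both sides of \<open>g ** N' = N ** cof3 g\<close> express the new brackets in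
  coordinates of the old frame. In this shape the law contains neither an inverse nor a
  determinant.\<close>

lemma structure_matrix_change:
  assumes u: "frame u" "structure_matrix u N" and u': "frame u'" "structure_matrix u' N'"
  obtains g where "det g \<noteq> 0" "g ** N' = N ** cof3 g"
    "\<And>w. comb (derived u') w = comb (derived u) (cof3 g *v w)"
proof -
  have uV: "range u \<subseteq> V" "range u' \<subseteq> V" using u(1) u'(1) by (auto simp: frame_def)
  have "\<forall>i. \<exists>x. u' i - comb u x \<in> Ann"
    using u(1) uV(2) unfolding frame_def by (meson rangeI subsetD)
  then obtain G where G: "\<And>i. u' i - comb u (G i) \<in> Ann" by metis
  define g :: "'k^3^3" where "g = transpose (\<chi> i. G i)"
  have "column i g = G i" for i
    by (simp add: g_def column_def transpose_def vec_eq_iff)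
  with G have g: "\<And>i. u' i - comb u (column i g) \<in> Ann" by simp
  have d: "comb (derived u') w = comb (derived u) (cof3 g *v w)" for w
    by (rule comb_derived_change[OF uV(1) g])
  have "x = 0" if "g *v x = 0" for x
  proof -
    have "comb u' x \<in> Ann" using comb_change[where u'=u' and x=x, OF g] that by simp
    then show ?thesis using u'(1) by (simp add: frame_def)
  qed
  then have "det g \<noteq> 0"
    by (metis invertible_det_nz invertible_left_inverse matrix_left_invertible_ker)
  moreover have "g *v (N' *v w) = N *v (cof3 g *v w)" for w
  proof (rule frame_unique[OF u(1)])
    have 1: "comb u (g *v (N' *v w)) - comb u' (N' *v w) \<in> Ann"
      using comb_change[OF g] Ann_diff_commute by blast
    have 2: "comb u' (N' *v w) - comb (derived u') w \<in> Ann"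
      using u'(2) Ann_diff_commute by (auto simp: structure_matrix_def)
    have 3: "comb (derived u') w - comb u (N *v (cof3 g *v w)) \<in> Ann"
      using u(2) by (auto simp: structure_matrix_def d)
    show "comb u (g *v (N' *v w)) - comb u (N *v (cof3 g *v w)) \<in> Ann"
      by (rule Ann_diff_trans[OF 1 Ann_diff_trans[OF 2 3]])
  qed
  then have "g ** N' = N ** cof3 g"
    by (simp add: matrix_eq matrix_vector_mul_assoc[symmetric])
  ultimately show thesis using d that by blast
qed

lemma frame_linear:
  assumes u: "frame u" and "det g \<noteq> 0"
  shows "frame (\<lambda>i. comb u (column i g))"
proof -
  have uV: "range u \<subseteq> V" using u by (auto simp: frame_def)
  have "invertible g" using assms(2) by (simp add: invertible_det_nz)
  then obtain k where k: "g ** k = mat 1" "k ** g = mat 1" by (auto simp: invertible_def)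
  show ?thesis
    unfolding frame_def comb_matrix
  proof (intro conjI ballI allI impI)
    show "range (\<lambda>i. comb u (column i g)) \<subseteq> V" using comb_in_V[OF uV] by auto
  next
    fix v assume "v \<in> V"
    then obtain x where x: "v - comb u x \<in> Ann" using u by (auto simp: frame_def)
    have "g *v (k *v x) = x" by (simp add: matrix_vector_mul_assoc k)
    then show "\<exists>x. v - comb u (g *v x) \<in> Ann" using x by metis
  next
    fix x assume "comb u (g *v x) \<in> Ann"
    then have "g *v x = 0" using u by (simp add: frame_def)
    then have "k *v (g *v x) = 0" by simp
    then show "x = 0" by (simp add: matrix_vector_mul_assoc k)
  qed
qed

text \<open>The adjugate as change of frame makes the determinants cancel exactly, so no square root
  is extracted and this direction works over the arbitrary field of the locale.\<close>

lemma frame_congruent: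
  assumes u: "frame u" "structure_matrix u N" and "matrix_congruent N N'"
  obtains u' where "frame u'" "structure_matrix u' N'"
proof -
  obtain h where h: "det h \<noteq> 0" "h ** N ** transpose h = N'"
    using assms(3) by (auto simp: matrix_congruent_def)
  have uV: "range u \<subseteq> V" using u(1) by (auto simp: frame_def)
  \<comment> \<open>The adjugate of \<open>h\<close>: both \<open>g h N h\<^sup>T\<close> and \<open>N cof3 g\<close> equal \<open>det h \<cdot> N h\<^sup>T\<close>.\<close>
  define g where "g = transpose (cof3 h)"
  have "det g * det h = det h * det h * det h"
    using transpose_cof3_mult[of h] unfolding g_def by (metis det_mul det_mat)
  then have g: "det g \<noteq> 0" using h(1) by auto
  define u' where "u' = (\<lambda>i. comb u (column i g))"
  have u'g: "\<And>i. u' i - comb u (column i g) \<in> Ann" by (simp add: u'_def Ann_closed)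
  have c: "comb u' x = comb u (g *v x)" for x by (simp add: u'_def comb_matrix)
  have f: "frame u'" unfolding u'_def by (rule frame_linear[OF u(1) g])
  have "g ** N' = mat (det h) ** (N ** transpose h)"
    unfolding h(2)[symmetric] g_def
    by (metis matrix_mul_assoc transpose_cof3_mult)
  also have "\<dots> = N ** cof3 g"
    unfolding g_def cof3_transpose_cof3 by (metis mat_mult_commute matrix_mul_assoc)
  finally have gN: "g ** N' = N ** cof3 g" .
  have "structure_matrix u' N'"
    unfolding structure_matrix_def
  proof
    fix w
    have "comb (derived u') w - comb u' (N' *v w) =
        comb (derived u) (cof3 g *v w) - comb u (N *v (cof3 g *v w))"
      by (simp add: comb_derived_change[OF uV u'g] c matrix_vector_mul_assoc gN)
    also have "\<dots> \<in> Ann" using u(2) by (auto simp: structure_matrix_def)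
    finally show "comb (derived u') w - comb u' (N' *v w) \<in> Ann" .
  qed
  with f that show thesis by blast
qed

lemma frame_structure_matrix_exists:
  assumes "frame u"
  obtains N where "structure_matrix u N"
proof -
  have uV: "range u \<subseteq> V" using assms by (auto simp: frame_def)
  then have "derived u i \<in> V" for i
    by (auto simp: derived_def intro!: br_closed)
  then have "\<forall>i. \<exists>x. derived u i - comb u x \<in> Ann"
    using assms by (auto simp: frame_def)
  then obtain X where X: "\<And>i. derived u i - comb u (X i) \<in> Ann" by metis
  define N :: "'k^3^3" where "N = transpose (\<chi> i. X i)"
  have "column i N = X i" for i
    by (simp add: N_def column_def transpose_def vec_eq_iff)
  with X have "\<And>i. derived u i - comb u (column i N) \<in> Ann" by simp
  then have "structure_matrix u N"
    unfolding structure_matrix_def using comb_change[where u'="derived u"] by blast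
  with that show thesis .
qed

section \<open>Existence and modification of frames\<close>

lemma frame_exists:
  assumes "dim V = n" "dim Ann = n - 3" "n \<ge> 3"
  obtains u where "frame u"
proof -
  obtain B where B: "B \<subseteq> Ann" "independent B" "Ann \<subseteq> span B" "card B = n - 3"
    using basis_exists[of Ann] assms(2) by metis
  have spanB: "span B = Ann"
    using B span_minimal[OF B(1) subspace_Ann] by blast
  obtain C where C: "B \<subseteq> C" "C \<subseteq> V" "independent C" "V \<subseteq> span C"
    using maximal_independent_subset_extend[of B V] B Ann_subset by blast
  have cardC: "card C = n" using basis_card_eq_dim[OF C(2,4,3)] assms(1) by simp
  \<comment> \<open>Infinite sets have cardinality 0. Finiteness is therefore read off from the
    positive cardinality of \<open>C\<close> and inherited by \<open>B\<close>, whose own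
    cardinality may be 0.\<close>
  then have finC: "finite C" using assms(3) by (metis card.infinite not_numeral_le_zero)
  have "card (C - B) = 3"
    using card_Diff_subset[of B C] finite_subset[OF C(1) finC] C(1) cardC B(4) assms(3) by simp
  then obtain a b c where abc: "C - B = {a, b, c}" "a \<noteq> b" "a \<noteq> c" "b \<noteq> c"
    by (auto simp: card_3_iff)
  then have C_eq: "C = insert a (insert b (insert c B))" and notin: "a \<notin> B" "b \<notin> B" "c \<notin> B"
    using C(1) by auto
  have indep: "a \<notin> span (insert b (insert c B))" "b \<notin> span (insert c B)" "c \<notin> span B"
    using C(3) notin abc unfolding C_eq independent_insert by auto
  define u :: "3 \<Rightarrow> 'v" where "u = (\<lambda>i. if i = 1 then a else if i = 2 then b else c)"
  have comb_u: "comb u x = scale (x$1) a + scale (x$2) b + scale (x$3) c" for x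
    by (simp add: comb_def u_def)
  have "frame u"
    unfolding frame_def
  proof (intro conjI ballI allI impI)
    show "range u \<subseteq> V" using C(2) by (auto simp: u_def C_eq)
  next
    fix v assume "v \<in> V"
    then have "v \<in> span C" using C(4) by blast
    then obtain k1 k2 k3 where "v - scale k1 a - scale k2 b - scale k3 c \<in> span B"
      unfolding C_eq span_insert by auto
    then have "v - comb u (vector [k1, k2, k3]) \<in> Ann"
      by (simp add: comb_u spanB algebra_simps)
    then show "\<exists>x. v - comb u x \<in> Ann" by blast
  next
    fix x assume "comb u x \<in> Ann"
    then have s: "comb u x \<in> span B" by (simp add: spanB)
    have "x$1 = 0"
    proof (rule ccontr)
      assume nz: "x$1 \<noteq> 0"
      have "scale (x$1) a = comb u x - scale (x$2) b - scale (x$3) c" by (simp add: comb_u)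
      also have "\<dots> \<in> span (insert b (insert c B))"
        using subsetD[OF span_mono s, of "insert b (insert c B)"]
        by (intro span_diff span_scale) (auto intro: span_base)
      finally have "scale (inverse (x$1)) (scale (x$1) a) \<in> span (insert b (insert c B))"
        by (rule span_scale)
      then show False using indep(1) nz by simp
    qed
    moreover have "x$2 = 0"
    proof (rule ccontr)
      assume nz: "x$2 \<noteq> 0"
      have "scale (x$2) b = comb u x - scale (x$3) c" by (simp add: comb_u \<open>x$1 = 0\<close>)
      also have "\<dots> \<in> span (insert c B)"
        using subsetD[OF span_mono s, of "insert c B"]
        by (intro span_diff span_scale) (auto intro: span_base)
      finally have "scale (inverse (x$2)) (scale (x$2) b) \<in> span (insert c B)"
        by (rule span_scale)
      then show False using indep(2) nz by simp
    qed
    moreover have "x$3 = 0"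
    proof (rule ccontr)
      assume nz: "x$3 \<noteq> 0"
      have "scale (x$3) c \<in> span B" using s by (simp add: comb_u \<open>x$1 = 0\<close> \<open>x$2 = 0\<close>)
      then have "scale (inverse (x$3)) (scale (x$3) c) \<in> span B"
        by (rule span_scale)
      then show False using indep(3) nz by simp
    qed
    ultimately show "x = 0" by (simp add: vec_eq_iff forall_3)
  qed
  with that show thesis .
qed

definition triple :: "'v \<Rightarrow> 'v \<Rightarrow> 'v \<Rightarrow> 3 \<Rightarrow> 'v" where
  "triple a b c i = (if i = 1 then a else if i = 2 then b else c)"

lemma triple_simps [simp]: "triple a b c 1 = a" "triple a b c 2 = b" "triple a b c 3 = c"
  by (simp_all add: triple_def)

lemma triple_eta: "triple (u 1) (u 2) (u 3) = u"
  using exhaust_3 by (auto simp: fun_eq_iff triple_def)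

lemma frame_triple_linear:
  assumes "frame (triple a b c)" "det (mat3 a1 b1 c1 a2 b2 c2 a3 b3 c3) \<noteq> 0"
  shows "frame (triple (scale a1 a + scale a2 b + scale a3 c)
    (scale b1 a + scale b2 b + scale b3 c) (scale c1 a + scale c2 b + scale c3 c))"
proof -
  have "frame (\<lambda>i. comb (triple a b c) (column i (mat3 a1 b1 c1 a2 b2 c2 a3 b3 c3)))" (is "frame ?u")
    by (rule frame_linear[OF assms])
  also have "?u = triple (?u 1) (?u 2) (?u 3)"
    by (rule triple_eta[symmetric])
  finally show ?thesis
    by (simp add: comb_def column_def)
qed

lemma frame_shift:
  assumes "frame u" "\<And>i. s i \<in> Ann"
  shows "frame (\<lambda>i. u i + s i)"
proof -
  have c: "comb (\<lambda>i. u i + s i) x = comb u x + comb s x" for x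
    by (simp add: comb_def scale_right_distrib)
  have s: "comb s x \<in> Ann" for x by (rule comb_in_Ann[OF assms(2)])
  show ?thesis
    unfolding frame_def
  proof (intro conjI ballI allI impI)
    show "range (\<lambda>i. u i + s i) \<subseteq> V"
      using V_closed(2)[OF frame_in_V[OF assms(1)] Ann_in_V[OF assms(2)]] by auto
  next
    fix v assume "v \<in> V"
    then obtain x where "v - comb u x \<in> Ann" using assms(1) by (auto simp: frame_def)
    then have "v - comb u x - comb s x \<in> Ann" using s by (rule Ann_closed)
    then show "\<exists>x. v - comb (\<lambda>i. u i + s i) x \<in> Ann" by (auto simp: c diff_diff_eq)
  next
    fix x assume "comb (\<lambda>i. u i + s i) x \<in> Ann"
    then have "comb (\<lambda>i. u i + s i) x - comb s x \<in> Ann" using s by (rule Ann_closed)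
    then show "x = 0" using assms(1) by (simp add: c frame_def)
  qed
qed

lemma frame_triple_shift:
  assumes "frame (triple a b c)" "s \<in> Ann" "t \<in> Ann" "r \<in> Ann"
  shows "frame (triple (a + s) (b + t) (c + r))"
proof -
  have "frame (\<lambda>i. triple a b c i + triple s t r i)"
    by (rule frame_shift[OF assms(1)]) (use assms in \<open>auto simp: triple_def\<close>)
  also have "(\<lambda>i. triple a b c i + triple s t r i) = triple (a + s) (b + t) (c + r)"
    by (auto simp: triple_def)
  finally show ?thesis .
qed

lemma frame_triple_in_V: "frame (triple a b c) \<Longrightarrow> a \<in> V \<and> b \<in> V \<and> c \<in> V"
  using frame_in_V[of "triple a b c" 1] frame_in_V[of "triple a b c" 2] frame_in_V[of "triple a b c" 3]
  by simp

lemma matrix_vector_mult_axis: "(M :: 'a::comm_ring_1^'n^'m) *v axis i 1 = column i M"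
  by (simp add: vec_eq_iff matrix_vector_mult_def column_def axis_def if_distrib[of "\<lambda>x. _ * x"]
      cong: if_cong)

lemma structure_matrix_brackets:
  assumes "structure_matrix u (mat3 a1 b1 c1 a2 b2 c2 a3 b3 c3)"
  obtains s t r where "s \<in> Ann" "t \<in> Ann" "r \<in> Ann"
    "br (u 2) (u 3) = scale a1 (u 1) + scale a2 (u 2) + scale a3 (u 3) + s"
    "br (u 3) (u 1) = scale b1 (u 1) + scale b2 (u 2) + scale b3 (u 3) + t"
    "br (u 1) (u 2) = scale c1 (u 1) + scale c2 (u 2) + scale c3 (u 3) + r"
proof -
  let ?N = "mat3 a1 b1 c1 a2 b2 c2 a3 b3 c3"
  have *: "derived u i - comb u (column i ?N) \<in> Ann" for i
    using assms[unfolded structure_matrix_def, THEN spec, of "axis i 1"]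
    by (simp add: matrix_vector_mult_axis)
  show thesis
    by (rule that[OF *[of 1] *[of 2] *[of 3]])
      (simp_all add: derived_def comb_def column_def)
qed

lemma br_diff_left: "x \<in> V \<Longrightarrow> y \<in> V \<Longrightarrow> z \<in> V \<Longrightarrow> br (x - y) z = br x z - br y z"
  using br_add_left[of x "- y" z] br_minus_left[of y z] V_closed(4)[of y] by simp

lemma br_diff_right: "x \<in> V \<Longrightarrow> y \<in> V \<Longrightarrow> z \<in> V \<Longrightarrow> br x (y - z) = br x y - br x z"
  using br_add_right[of x y "- z"] br_minus_right[of x z] V_closed(4)[of z] by simp

lemmas br_simps = br_add_left br_add_right br_diff_left br_diff_right br_scale_left br_scale_right
  br_minus_left br_minus_right br_Ann br_self V_closed Ann_in_V

lemma independent_pair: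
  assumes "q \<noteq> 0" "\<And>z. r \<noteq> scale z q"
  shows "independent {r, q}" "r \<noteq> q"
proof -
  show "r \<noteq> q" using assms(2)[of 1] by simp
  then show "independent {r, q}" using assms by (auto simp: independent_insert span_singleton)
qed

lemma in_AnnI:
  assumes "frame (triple a b c)" "v \<in> V" "br v a = 0" "br v b = 0" "br v c = 0"
  shows "v \<in> Ann"
proof -
  have V: "a \<in> V" "b \<in> V" "c \<in> V" using frame_triple_in_V[OF assms(1)] by auto
  have "br v y = 0" if y: "y \<in> V" for y
  proof -
    obtain x where "y - comb (triple a b c) x \<in> Ann" using assms(1) y by (auto simp: frame_def)
    moreover have "v - v \<in> Ann" by (simp add: Ann_closed)
    ultimately have "br v y = br v (comb (triple a b c) x)"
      by (intro br_cong_Ann[of v _ v]) (use assms V in \<open>simp_all add: comb_def V_closed\<close>)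
    also have "\<dots> = 0" using assms V by (simp add: comb_def br_simps)
    finally show ?thesis .
  qed
  then show ?thesis using assms(2) by (simp add: annihilator_def)
qed

lemma frame_triple_notin_Ann:
  assumes "frame (triple a b c)"
  shows "a \<notin> Ann" "b \<notin> Ann" "c \<notin> Ann"
proof -
  have "triple a b c i \<notin> Ann" for i
  proof
    assume "triple a b c i \<in> Ann"
    then have "comb (triple a b c) (axis i 1) \<in> Ann" by simp
    then have "(axis i 1 :: 'k^3) = 0" using assms unfolding frame_def by blast
    then show False by (simp add: axis_eq_0_iff)
  qed
  from this[of 1] this[of 2] this[of 3] show "a \<notin> Ann" "b \<notin> Ann" "c \<notin> Ann" by simp_all
qed

end

section \<open>Existence of an isomorphism with a member of the list\<close>

locale codim3_algebra = anticommutative_algebra scale V br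
  for scale :: "complex \<Rightarrow> 'v::ab_group_add \<Rightarrow> 'v" and V br +
  fixes n :: nat
  assumes n_ge_3: "n \<ge> 3" and dim_V: "dim V = n" and dim_Ann: "dim Ann = n - 3"
begin

lemma Ann_basis_extend:
  assumes "set as \<subseteq> Ann" "distinct as" "independent (set as)"
  obtains bs where "distinct (as @ bs)" "independent (set (as @ bs))"
    "span (set (as @ bs)) = Ann" "length (as @ bs) = n - 3"
proof -
  obtain B where B: "B \<subseteq> V" "independent B" "V \<subseteq> span B" "card B = n"
    using basis_exists[of V] dim_V by metis
  have finB: "finite B" using B(4) n_ge_3 by (metis card.infinite not_numeral_le_zero)
  obtain C where C: "set as \<subseteq> C" "C \<subseteq> Ann" "independent C" "Ann \<subseteq> span C"
    using maximal_independent_subset_extend[OF assms(1,3)] by blast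
  have "C \<subseteq> span B" using C(2) Ann_subset B(3) by blast
  then have finC: "finite C" using independent_span_bound[OF finB C(3)] by blast
  have cardC: "card C = n - 3" using basis_card_eq_dim[OF C(2,4,3)] dim_Ann by simp
  obtain bs where bs: "set bs = C - set as" "distinct bs"
    using finite_distinct_list[of "C - set as"] finC by auto
  have set: "set (as @ bs) = C" using bs C(1) by auto
  have dist: "distinct (as @ bs)" using bs assms(2) by auto
  show thesis
  proof (rule that[OF dist])
    show "independent (set (as @ bs))" unfolding set by (rule C(3))
    show "span (set (as @ bs)) = Ann"
      unfolding set using C(2,4) span_minimal[OF C(2) subspace_Ann] by blast
    show "length (as @ bs) = n - 3" using distinct_card[OF dist] set cardC by simp
  qed
qed

text \<open>The vectors \<open>as\<close> are the annihilator elements that the table names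
  \<open>\<ee> 4\<close>, \<open>\<ee> 5\<close> and so on; the remaining basis of the annihilator
  is arbitrary. The linear map \<open>g\<close> goes from coordinates to the algebra, so that a
  table is verified by evaluating \<open>g\<close> on its entries; the isomorphism is the inverse of
  \<open>g\<close> on \<open>coord_space n\<close>.\<close>

lemma frame_table_iso:
  assumes u: "frame u" and as: "set as \<subseteq> Ann" "distinct as" "independent (set as)"
  obtains g where "length as \<le> n - 3"
    "\<And>x y. g (x + y) = g x + g y" "\<And>c x. g (c *\<^sub>c x) = scale c (g x)"
    "g (\<ee> 1) = u 1" "g (\<ee> 2) = u 2" "g (\<ee> 3) = u 3"
    "\<And>j. j < length as \<Longrightarrow> g (\<ee> (4 + j)) = as ! j"
    "\<And>p q r. p \<in> coord_space n \<Longrightarrow> q \<in> coord_space n \<Longrightarrow> r \<in> coord_space n \<Longrightarrow>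
      g p = br (u 1) (u 2) \<Longrightarrow> g q = br (u 1) (u 3) \<Longrightarrow> g r = br (u 2) (u 3) \<Longrightarrow>
      algebra_iso scale V br vscale (coord_space n) (table p q r)"
proof -
  obtain bs where bs: "distinct (as @ bs)" "independent (set (as @ bs))"
    "span (set (as @ bs)) = Ann" "length (as @ bs) = n - 3"
    by (rule Ann_basis_extend[OF as])
  define cs where "cs = as @ bs"
  define m where "m = length cs"
  have cs: "distinct cs" "independent (set cs)" "span (set cs) = Ann" and n: "n = m + 3"
    using bs n_ge_3 by (auto simp: cs_def m_def)
  define top :: "(nat \<Rightarrow> complex) \<Rightarrow> complex^3" where "top y = vector [y 1, y 2, y 3]" for y
  define low where "low y = (\<Sum>j<m. scale (y (4 + j)) (cs ! j))" for y :: "nat \<Rightarrow> complex"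
  define g where "g y = comb u (top y) + low y" for y
  have uV: "range u \<subseteq> V" using u by (auto simp: frame_def)
  have bij: "bij_betw ((!) cs) {..<m} (set cs)"
    using cs(1) by (intro bij_betw_nth) (auto simp: m_def)
  \<comment> \<open>Independence and span speak of the set of list entries; \<open>ix\<close> turns
    the indexed sum into a sum over that set.\<close>
  define ix where "ix = the_inv_into {..<m} ((!) cs)"
  have ix: "ix (cs ! j) = j" if "j < m" for j
    using the_inv_into_f_f[OF bij_betw_imp_inj_on[OF bij]] that by (simp add: ix_def)
  have low_sum: "low y = (\<Sum>c\<in>set cs. scale (y (4 + ix c)) c)" for y
    using sum.reindex_bij_betw[OF bij, of "\<lambda>c. scale (y (4 + ix c)) c"] by (simp add: low_def ix)
  have low_Ann: "low y \<in> Ann" for y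
    unfolding low_sum cs(3)[symmetric] by (intro span_sum span_scale span_base)
  have add: "g (x + y) = g x + g y" for x y
  proof -
    have "top (x + y) = top x + top y" by (simp add: top_def vec_eq_iff forall_3)
    then show ?thesis
      by (simp add: g_def low_def comb_add scale_left_distrib sum.distrib)
  qed
  have scl: "g (c *\<^sub>c x) = scale c (g x)" for c x
  proof -
    have "top (c *\<^sub>c x) = c *s top x" by (simp add: top_def vec_eq_iff forall_3 vscale_def)
    then show ?thesis
      by (simp add: g_def low_def comb_scale scale_right_distrib vscale_def scale_sum_right)
  qed
  have inj: "y = 0" if "y \<in> coord_space n" "g y = 0" for y
  proof -
    have "comb u (top y) = - low y" using that(2) by (simp add: g_def eq_neg_iff_add_eq_0)
    then have "comb u (top y) \<in> Ann" using low_Ann Ann_closed by simp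
    then have top0: "top y = 0" using u by (simp add: frame_def)
    then have "low y = 0" using that(2) by (simp add: g_def)
    then have *: "y (4 + ix c) = 0" if "c \<in> set cs" for c
      using independentD[OF cs(2) finite_set order_refl, where u="\<lambda>c. y (4 + ix c)"] that
      unfolding low_sum by blast
    have low0: "y (4 + j) = 0" if "j < m" for j
      using *[of "cs ! j"] that by (simp add: ix m_def)
    have top0': "y 1 = 0" "y 2 = 0" "y 3 = 0"
      using top0 by (auto simp: top_def vec_eq_iff forall_3)
    have "y i = 0" for i
    proof (cases "i \<in> {4..n}")
      case True
      then show ?thesis using low0[of "i - 4"] by (auto simp: n)
    next
      case False
      then consider "i \<notin> {1..n}" | "i = 1" | "i = 2" | "i = 3" by force
      then show ?thesis using top0' that(1) by cases (auto simp: coord_space_def)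
    qed
    then show "y = 0" by (simp add: fun_eq_iff)
  qed
  have surj: "\<exists>y\<in>coord_space n. g y = v" if v: "v \<in> V" for v
  proof -
    obtain x where "v - comb u x \<in> Ann" using u v by (auto simp: frame_def)
    then have "v - comb u x \<in> span (set cs)" using cs(3) by simp
    then obtain r where r: "v - comb u x = (\<Sum>c\<in>set cs. scale (r c) c)"
      unfolding span_finite[OF finite_set] by auto
    define y where "y i = (if i = 1 then x$1 else if i = 2 then x$2 else if i = 3 then x$3
      else if i \<in> {4..<4+m} then r (cs ! (i - 4)) else 0)" for i :: nat
    have "top y = x" by (simp add: top_def y_def vec_eq_iff forall_3)
    moreover have "low y = (\<Sum>j<m. scale (r (cs ! j)) (cs ! j))"
      unfolding low_def by (intro sum.cong) (auto simp: y_def)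
    then have "low y = (\<Sum>c\<in>set cs. scale (r c) c)"
      using sum.reindex_bij_betw[OF bij, of "\<lambda>c. scale (r c) c"] by simp
    ultimately have "g y = v" using r by (simp add: g_def algebra_simps)
    moreover have "y \<in> coord_space n" by (auto simp: coord_space_def y_def n)
    ultimately show ?thesis by blast
  qed
  have gV: "g y \<in> V" for y
    unfolding g_def by (intro V_closed comb_in_V uV Ann_in_V low_Ann)
  have g_diff: "g (x - y) = g x - g y" for x y
    using add[of "x - y" y] by (simp add: algebra_simps)
  have bij_g: "bij_betw g (coord_space n) V"
    unfolding bij_betw_def
  proof
    show "inj_on g (coord_space n)"
    proof (rule inj_onI)
      fix x y assume xy: "x \<in> coord_space n" "y \<in> coord_space n" "g x = g y"
      have "x - y \<in> coord_space n"
        using xy(1,2) by (auto simp: coord_space_def)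
      then show "x = y" using inj[of "x - y"] xy(3) by (simp add: g_diff)
    qed
    show "g ` coord_space n = V" using gV surj by blast
  qed
  define f where "f = the_inv_into (coord_space n) g"
  have fg: "f (g y) = y" if "y \<in> coord_space n" for y
    using bij_g that by (simp add: f_def bij_betw_def the_inv_into_f_f)
  have gf: "g (f v) = v" and fV: "f v \<in> coord_space n" if "v \<in> V" for v
    using bij_g that f_the_inv_into_f_bij_betw[of g "coord_space n" V v]
      the_inv_into_into[of g "coord_space n" v "coord_space n"]
    by (auto simp: f_def bij_betw_def)
  have bij_f: "bij_betw f V (coord_space n)"
    unfolding f_def by (rule bij_betw_the_inv_into[OF bij_g])
  have iso: "algebra_iso scale V br vscale (coord_space n) (table p q r)"
    if pqr: "p \<in> coord_space n" "q \<in> coord_space n" "r \<in> coord_space n"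
      "g p = br (u 1) (u 2)" "g q = br (u 1) (u 3)" "g r = br (u 2) (u 3)" for p q r
    unfolding algebra_iso_def
  proof (rule exI[of _ f], intro conjI ballI allI bij_f)
    fix x y assume xy: "x \<in> V" "y \<in> V"
    have "f (g (f x + f y)) = f x + f y" by (intro fg coord_space_closed fV xy)
    then show "f (x + y) = f x + f y" by (simp add: add gf xy)
    have "u 1 \<in> V" "u 3 \<in> V" using uV by auto
    then have q': "br (u 3) (u 1) = - br (u 1) (u 3)" by (rule br_anticomm[rotated])
    have "g (table p q r (f x) (f y)) = comb (derived u) (cross3 (top (f x)) (top (f y)))"
      by (simp add: table_def add scl pqr comb_def derived_def cross3_def top_def q'
          scale_left_diff_distrib algebra_simps)
    also have "\<dots> = br (comb u (top (f x))) (comb u (top (f y)))"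
      by (simp add: br_comb[OF uV])
    also have "\<dots> = br (g (f x)) (g (f y))"
      by (rule br_cong_Ann[symmetric]) (auto simp: g_def low_Ann comb_in_V[OF uV])
    also have "\<dots> = br x y" by (simp add: gf xy)
    finally have "f (br x y) = f (g (table p q r (f x) (f y)))" by simp
    also have "\<dots> = table p q r (f x) (f y)"
      unfolding table_def by (intro fg coord_space_closed pqr)
    finally show "f (br x y) = table p q r (f x) (f y)" .
  next
    fix c x assume x: "x \<in> V"
    have "f (g (c *\<^sub>c f x)) = c *\<^sub>c f x" by (intro fg coord_space_closed fV x)
    then show "f (scale c x) = c *\<^sub>c f x" by (simp add: scl gf x)
  qed
  have top_e: "top (\<ee> 1) = axis 1 1" "top (\<ee> 2) = axis 2 1" "top (\<ee> 3) = axis 3 1"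
    "top (\<ee> (4 + j)) = 0" for j
    by (simp_all add: top_def \<ee>_def vec_eq_iff forall_3 axis_def)
  have low_e: "low (\<ee> 1) = 0" "low (\<ee> 2) = 0" "low (\<ee> 3) = 0"
    by (simp_all add: low_def \<ee>_def)
  have low_e': "low (\<ee> (4 + j)) = cs ! j" if "j < m" for j
  proof -
    have "low (\<ee> (4 + j)) = (\<Sum>i<m. if i = j then cs ! i else 0)"
      unfolding low_def by (intro sum.cong) (auto simp: \<ee>_def)
    then show ?thesis using that by simp
  qed
  show thesis
  proof (rule that[of g])
    show "length as \<le> n - 3" using bs(4) by simp
    show "g (\<ee> (4 + j)) = as ! j" if "j < length as" for j
    proof -
      have "j < m" "cs ! j = as ! j" using that by (auto simp: m_def cs_def nth_append)
      then show ?thesis by (simp only: g_def top_e low_e' comb_0 add_0)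
    qed
    show "g (\<ee> 1) = u 1" "g (\<ee> 2) = u 2" "g (\<ee> 3) = u 3"
      by (simp_all only: g_def top_e low_e comb_axis add_0_right)
  qed (fact add scl iso)+
qed

section \<open>From structure matrices to multiplication tables\<close>

text \<open>The ranges of indices are cumulative in \<open>n\<close>: a table that uses k basis
  vectors of the annihilator exists in every dimension from 3 + k on.\<close>

definition classified :: bool where
  "classified \<longleftrightarrow> (\<exists>i. (i \<in> {1..6} \<or> (n \<ge> 4 \<and> i \<in> {1..12}) \<or> (n \<ge> 5 \<and> i \<in> {1..15}) \<or>
      (n \<ge> 6 \<and> i \<in> {1..16})) \<and>
    (\<exists>\<alpha>\<in>params i. algebra_iso scale V br vscale (coord_space n) (A_br i \<alpha>)))"

text \<open>Independence of \<open>as\<close> inside the annihilator gives the bound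
  \<open>3 + length as \<le> n\<close>, which is what makes the index available. The last premise
  asks for the brackets under an arbitrary linear map with the prescribed values, so a table is
  checked by pure rewriting.\<close>

lemma classifiedI:
  assumes "frame (triple a b c)" "set as \<subseteq> Ann" "distinct as" "independent (set as)"
    and idx: "i \<in> {1..6} \<or> (length as = 1 \<and> i \<in> {1..12}) \<or> (length as = 2 \<and> i \<in> {1..15}) \<or>
      (length as = 3 \<and> i \<in> {1..16})"
    and \<alpha>: "\<alpha> \<in> params i" and A: "A_br i \<alpha> = table p q r"
    and pqr: "p \<in> coord_space (3 + length as)" "q \<in> coord_space (3 + length as)"
      "r \<in> coord_space (3 + length as)"
    and brackets: "\<And>g. \<lbrakk>\<And>x y. g (x + y) = g x + g y; \<And>c x. g (c *\<^sub>c x) = scale c (g x);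
      g 0 = 0; \<And>x. g (- x) = - g x; g (\<ee> 1) = a; g (\<ee> 2) = b; g (\<ee> 3) = c;
      \<forall>j<length as. g (\<ee> (4 + j)) = as ! j\<rbrakk> \<Longrightarrow> g p = br a b \<and> g q = br a c \<and> g r = br b c"
  shows classified
proof (rule frame_table_iso[OF assms(1-4)])
  fix g
  assume len: "length as \<le> n - 3" and add: "\<And>x y. g (x + y) = g x + g y"
    and scl: "\<And>c x. g (c *\<^sub>c x) = scale c (g x)"
    and g: "g (\<ee> 1) = triple a b c 1" "g (\<ee> 2) = triple a b c 2" "g (\<ee> 3) = triple a b c 3"
      "\<And>j. j < length as \<Longrightarrow> g (\<ee> (4 + j)) = as ! j"
    and iso: "\<And>p q r. p \<in> coord_space n \<Longrightarrow> q \<in> coord_space n \<Longrightarrow> r \<in> coord_space n \<Longrightarrow>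
      g p = br (triple a b c 1) (triple a b c 2) \<Longrightarrow> g q = br (triple a b c 1) (triple a b c 3) \<Longrightarrow>
      g r = br (triple a b c 2) (triple a b c 3) \<Longrightarrow>
      algebra_iso scale V br vscale (coord_space n) (table p q r)"
  have z: "g 0 = 0" using add[of 0 0] by simp
  have neg: "g (- x) = - g x" for x
    using add[of x "- x"] z by (simp add: eq_neg_iff_add_eq_0 add.commute)
  have "coord_space (3 + length as) \<subseteq> coord_space n"
    using len n_ge_3 by (auto simp: coord_space_def)
  then have "algebra_iso scale V br vscale (coord_space n) (A_br i \<alpha>)"
    unfolding A using brackets[OF add scl z neg] g pqr by (intro iso) auto
  moreover have "i \<in> {1..6} \<or> (n \<ge> 4 \<and> i \<in> {1..12}) \<or> (n \<ge> 5 \<and> i \<in> {1..15}) \<or>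
      (n \<ge> 6 \<and> i \<in> {1..16})"
    using idx len n_ge_3 by auto
  ultimately show ?thesis using \<alpha> unfolding classified_def by blast
qed

lemmas table_intros = coord_space_closed e_in_coord_space

lemma frame_brackets:
  assumes "frame u" "structure_matrix u (mat3 a1 b1 c1 a2 b2 c2 a3 b3 c3)"
  obtains a b c s t r where "frame (triple a b c)" "a \<in> V" "b \<in> V" "c \<in> V"
    "s \<in> Ann" "t \<in> Ann" "r \<in> Ann"
    "br b c = scale a1 a + scale a2 b + scale a3 c + s"
    "br a c = - (scale b1 a + scale b2 b + scale b3 c + t)"
    "br a b = scale c1 a + scale c2 b + scale c3 c + r"
proof -
  have f: "frame (triple (u 1) (u 2) (u 3))" using assms(1) by (simp add: triple_eta)
  have "u 1 \<in> V" "u 2 \<in> V" "u 3 \<in> V" using frame_in_V[OF assms(1)] by auto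
  with structure_matrix_brackets[OF assms(2)] f br_anticomm[of "u 1" "u 3"] that show thesis
    by metis
qed

context
  fixes u :: "3 \<Rightarrow> 'v"
  assumes u: "frame u"
begin

text \<open>The kernel of this structure matrix is the direction of the bracket of \<open>a\<close>
  and \<open>b\<close>. Its value \<open>r\<close> is the only annihilator component that cannot be
  absorbed: it separates algebra 1 from algebra 8.\<close>

lemma classified_N1:
  assumes "structure_matrix u (mat3 0 (-1) 0 1 0 0 0 0 0)"
  shows classified
proof -
  obtain a b c s t r where f: "frame (triple a b c)" and V: "a \<in> V" "b \<in> V" "c \<in> V"
    and A: "s \<in> Ann" "t \<in> Ann" "r \<in> Ann" and br: "br b c = b + s" "br a c = a - t" "br a b = r"
    by (rule frame_brackets[OF u assms]) simp
  have f': "frame (triple (a - t) (b + s) c)"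
    using frame_triple_shift[OF f, of "- t" s 0] A by (simp add: Ann_closed)
  show ?thesis
  proof (cases "r = 0")
    case True
    show ?thesis
      by (rule classifiedI[OF f', of "[]" 1 0 0 "\<ee> 1" "\<ee> 2"])
        (use V A br True in \<open>auto simp: params_def A_br_def br_simps independent_empty intro!: table_intros\<close>)
  next
    case False
    show ?thesis
      by (rule classifiedI[OF f', of "[r]" 8 0 "\<ee> 4" "\<ee> 1" "\<ee> 2"])
        (use V A br False in \<open>auto simp: params_def A_br_def br_simps independent_empty intro!: table_intros\<close>)
  qed
qed

lemma classified_N2:
  assumes "structure_matrix u (mat3 0 (-1) 0 \<alpha> (-1) 0 0 0 0)" and \<alpha>: "\<alpha> \<in> C_gt1 \<union> {1}"
  shows classified
proof -
  have nz: "\<alpha> \<noteq> 0" using \<alpha> zero_notin_C_gt1 by auto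
  obtain a b c s t r where f: "frame (triple a b c)" and V: "a \<in> V" "b \<in> V" "c \<in> V"
    and A: "s \<in> Ann" "t \<in> Ann" "r \<in> Ann"
    and br: "br b c = scale \<alpha> b + s" "br a c = a + b - t" "br a b = r"
    by (rule frame_brackets[OF u assms(1)]) (simp add: algebra_simps)
  define s' where "s' = scale (inverse \<alpha>) s"
  have s': "s' \<in> Ann" "scale \<alpha> s' = s" using A nz by (auto simp: s'_def Ann_closed)
  \<comment> \<open>The second vector absorbs \<open>s\<close> divided by \<alpha>. The first one is
    corrected by \<open>- s'\<close> so that the sum of both, which is the value of their bracket
    relation with \<open>c\<close>, stays \<open>a + b - t\<close>.\<close>
  have f': "frame (triple (a - t - s') (b + s') c)"
    using frame_triple_shift[OF f, of "- t - s'" s' 0] A s' by (simp add: Ann_closed algebra_simps)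
  show ?thesis
  proof (cases "r = 0")
    case True
    show ?thesis
      by (rule classifiedI[OF f', of "[]" 2 \<alpha> 0 "\<ee> 1 + \<ee> 2" "\<alpha> *\<^sub>c \<ee> 2"])
        (use V A br True s' \<alpha> in
          \<open>auto simp: params_def A_br_def br_simps independent_empty scale_right_distrib intro!: table_intros\<close>)
  next
    case False
    show ?thesis
      by (rule classifiedI[OF f', of "[r]" 9 \<alpha> "\<ee> 4" "\<ee> 1 + \<ee> 2" "\<alpha> *\<^sub>c \<ee> 2"])
        (use V A br False s' \<alpha> in
          \<open>auto simp: params_def A_br_def br_simps independent_empty scale_right_distrib intro!: table_intros\<close>)
  qed
qed

lemma classified_N3:
  assumes "structure_matrix u (mat 1)"
  shows classified
proof -
  obtain a b c s t r where f: "frame (triple a b c)" and V: "a \<in> V" "b \<in> V" "c \<in> V"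
    and A: "s \<in> Ann" "t \<in> Ann" "r \<in> Ann"
    and br: "br b c = a + s" "br a c = - (b + t)" "br a b = c + r"
    by (rule frame_brackets[OF u assms[unfolded mat_1_mat3]]) simp
  have f': "frame (triple (a + s) (b + t) (c + r))"
    using frame_triple_shift[OF f A] .
  show ?thesis
    by (rule classifiedI[OF f', of "[]" 3 0 "\<ee> 3" "- \<ee> 2" "\<ee> 1"])
      (use V A br in \<open>auto simp: params_def A_br_def br_simps independent_empty intro!: table_intros\<close>)
qed

lemma classified_N4:
  assumes "structure_matrix u (mat3 0 (-1) 0 \<alpha> 0 0 0 (-1) 1)" and \<alpha>: "\<alpha> \<in> C_gt1 \<union> {0, 1}"
  shows classified
proof -
  obtain a b c s t r where f: "frame (triple a b c)" and V: "a \<in> V" "b \<in> V" "c \<in> V"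
    and A: "s \<in> Ann" "t \<in> Ann" "r \<in> Ann"
    and br: "br b c = scale \<alpha> b + s" "br a c = a + c - t" "br a b = c + r"
    by (rule frame_brackets[OF u assms(1)]) (simp add: algebra_simps)
  show ?thesis
  proof (cases "\<alpha> = 0 \<and> s \<noteq> 0")
    case False
    \<comment> \<open>If \<alpha> = 0, then \<open>s\<close> is zero in this case and
      \<open>inverse 0 = 0\<close> keeps the formula valid.\<close>
    define s' where "s' = scale (inverse \<alpha>) s"
    have s': "s' \<in> Ann" "scale \<alpha> s' = s" using A False by (auto simp: s'_def Ann_closed)
    have f': "frame (triple (a - t - r) (b + s') (c + r))"
      using frame_triple_shift[OF f, of "- t - r" s' r] A s' by (simp add: Ann_closed algebra_simps)
    show ?thesis
      by (rule classifiedI[OF f', of "[]" 4 \<alpha> "\<ee> 3" "\<ee> 1 + \<ee> 3" "\<alpha> *\<^sub>c \<ee> 2"])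
        (use V A br s' \<alpha> in
          \<open>auto simp: params_def A_br_def br_simps independent_empty scale_right_distrib intro!: table_intros\<close>)
  next
    case True
    have f': "frame (triple (a - t - r) b (c + r))"
      using frame_triple_shift[OF f, of "- t - r" 0 r] A by (simp add: Ann_closed algebra_simps)
    show ?thesis
      by (rule classifiedI[OF f', of "[s]" 11 0 "\<ee> 3" "\<ee> 1 + \<ee> 3" "\<ee> 4"])
        (use V A br True in \<open>auto simp: params_def A_br_def br_simps independent_empty intro!: table_intros\<close>)
  qed
qed

text \<open>The middle column vanishes, so the bracket of \<open>a\<close> and \<open>c\<close> is
  the one whose annihilator value survives: zero for algebra 5, nonzero for algebra 12.\<close>

lemma classified_N5:
  assumes "structure_matrix u (mat3 0 0 1 1 0 0 0 0 0)"
  shows classified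
proof -
  obtain a b c s t r where f: "frame (triple a b c)" and V: "a \<in> V" "b \<in> V" "c \<in> V"
    and A: "s \<in> Ann" "t \<in> Ann" "r \<in> Ann" and br: "br b c = b + s" "br a c = - t" "br a b = a + r"
    by (rule frame_brackets[OF u assms]) simp
  have f': "frame (triple (a + r) (b + s) c)"
    using frame_triple_shift[OF f, of r s 0] A by (simp add: Ann_closed)
  show ?thesis
  proof (cases "t = 0")
    case True
    show ?thesis
      by (rule classifiedI[OF f', of "[]" 5 0 "\<ee> 1" 0 "\<ee> 2"])
        (use V A br True in \<open>auto simp: params_def A_br_def br_simps independent_empty intro!: table_intros\<close>)
  next
    case False
    show ?thesis
      by (rule classifiedI[OF f', of "[- t]" 12 0 "\<ee> 1" "\<ee> 4" "\<ee> 2"])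
        (use V A br False in \<open>auto simp: params_def A_br_def br_simps independent_empty Ann_closed intro!: table_intros\<close>)
  qed
qed

lemma classified_N6:
  assumes "structure_matrix u (mat3 0 (-1) 0 1 0 0 0 0 1)"
  shows classified
proof -
  obtain a b c s t r where f: "frame (triple a b c)" and V: "a \<in> V" "b \<in> V" "c \<in> V"
    and A: "s \<in> Ann" "t \<in> Ann" "r \<in> Ann"
    and br: "br b c = b + s" "br a c = a - t" "br a b = c + r"
    by (rule frame_brackets[OF u assms]) simp
  have f': "frame (triple (a - t) (b + s) (c + r))"
    using frame_triple_shift[OF f, of "- t" s r] A by (simp add: Ann_closed)
  show ?thesis
    by (rule classifiedI[OF f', of "[]" 6 0 "\<ee> 3" "\<ee> 1" "\<ee> 2"])
      (use V A br in \<open>auto simp: params_def A_br_def br_simps independent_empty intro!: table_intros\<close>)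
qed

text \<open>Two brackets of \<open>a\<close> take values in the annihilator, and not both vanish,
  since otherwise \<open>a\<close> would lie in the annihilator. If they are independent, algebra 14
  results; if they are dependent, a linear change of frame makes one of them zero and gives algebra
  7.\<close>

lemma classified_square:
  assumes "structure_matrix u (mat3 1 0 0 0 0 0 0 0 0)"
  shows classified
proof -
  obtain a0 b c s t r where f0: "frame (triple a0 b c)" and V0: "a0 \<in> V" "b \<in> V" "c \<in> V"
    and A: "s \<in> Ann" "t \<in> Ann" "r \<in> Ann"
    and br0: "br b c = a0 + s" "br a0 c = - t" "br a0 b = r"
    by (rule frame_brackets[OF u assms]) simp
  define a q where "a = a0 + s" and "q = - t"
  have f: "frame (triple a b c)"
    unfolding a_def using frame_triple_shift[OF f0, of s 0 0] A by (simp add: Ann_closed)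
  have V: "a \<in> V" "b \<in> V" "c \<in> V" and q: "q \<in> Ann" using V0 A by (simp_all add: a_def q_def V_closed Ann_in_V Ann_closed)
  have br: "br b c = a" "br a c = q" "br a b = r"
    using V0 A br0 by (simp_all add: a_def q_def br_simps)
  consider "independent {r, q}" "r \<noteq> q" | "q = 0" "r \<noteq> 0" | z where "r = scale z q" "q \<noteq> 0"
  proof -
    have "q \<noteq> 0 \<or> r \<noteq> 0"
      using in_AnnI[OF f V(1)] frame_triple_notin_Ann(1)[OF f] br V by (auto simp: br_self)
    then show thesis
      using that independent_pair by blast
  qed
  then show ?thesis
  proof cases
    case 1
    then show ?thesis
      by (intro classifiedI[OF f, of "[r, q]" 14 0 "\<ee> 4" "\<ee> 5" "\<ee> 1"])
        (use V A q br in \<open>auto simp: params_def A_br_def All_less_Suc intro!: table_intros\<close>)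
  next
    case 2
    then show ?thesis
      by (intro classifiedI[OF f, of "[r]" 7 0 "\<ee> 4" 0 "\<ee> 1"])
        (use V A q br in \<open>auto simp: params_def A_br_def intro!: table_intros\<close>)
  next
    case (3 z)
    \<comment> \<open>As \<open>r\<close> is \<open>z\<close> times \<open>q\<close>, the vector
      \<open>scale z c - b\<close> commutes with \<open>a\<close>, and its bracket with
      \<open>c\<close> is again \<open>a\<close>.\<close>
    have f': "frame (triple a c (scale z c - b))"
      using frame_triple_linear[OF f, of 1 0 0 0 0 "-1" 0 1 z] by (simp add: det_mat3)
    have "br a c = q" "br a (scale z c - b) = 0" "br c (scale z c - b) = a"
      using V br 3 br_anticomm[of c b] by (simp_all add: br_simps)
    then show ?thesis
      by (intro classifiedI[OF f', of "[q]" 7 0 "\<ee> 4" 0 "\<ee> 1"])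
        (use 3 q in \<open>auto simp: params_def A_br_def intro!: table_intros\<close>)
  qed
qed

text \<open>Here \<open>b\<close> is the vector with two brackets in the annihilator, not both zero.
  In contrast to the square case, the two ways of being dependent lead to different algebras: 10 if
  \<open>p\<close> vanishes, and 9 with parameter 0 otherwise.\<close>

lemma classified_mixed:
  assumes "structure_matrix u (mat3 0 (-1) 0 0 (-1) 0 0 0 0)"
  shows classified
proof -
  obtain a0 b c r t p where f0: "frame (triple a0 b c)" and V0: "a0 \<in> V" "b \<in> V" "c \<in> V"
    and A: "r \<in> Ann" "t \<in> Ann" "p \<in> Ann"
    and br0: "br b c = r" "br a0 c = a0 + b - t" "br a0 b = p"
    by (rule frame_brackets[OF u assms]) (simp add: algebra_simps)
  define a where "a = a0 - t"
  have f: "frame (triple a b c)"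
    unfolding a_def using frame_triple_shift[OF f0, of "- t" 0 0] A by (simp add: Ann_closed)
  have V: "a \<in> V" "b \<in> V" "c \<in> V" using V0 A by (simp_all add: a_def V_closed Ann_in_V)
  have br: "br b c = r" "br a c = a + b" "br a b = p"
    using V0 A br0 by (simp_all add: a_def br_simps)
  consider "independent {r, p}" "r \<noteq> p" | "p = 0" "r \<noteq> 0" | z where "r = scale z p" "p \<noteq> 0"
  proof -
    have "p \<noteq> 0 \<or> r \<noteq> 0"
      using in_AnnI[OF f V(2)] frame_triple_notin_Ann(2)[OF f] br V br_anticomm[of b a]
      by (auto simp: br_self)
    then show thesis
      using that independent_pair by blast
  qed
  then show ?thesis
  proof cases
    case 1
    then show ?thesis
      by (intro classifiedI[OF f, of "[p, r]" 15 0 "\<ee> 4" "\<ee> 1 + \<ee> 2" "\<ee> 5"])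
        (use V A br in \<open>auto simp: params_def A_br_def All_less_Suc insert_commute intro!: table_intros\<close>)
  next
    case 2
    then show ?thesis
      by (intro classifiedI[OF f, of "[r]" 10 0 0 "\<ee> 1 + \<ee> 2" "\<ee> 4"])
        (use V A br in \<open>auto simp: params_def A_br_def intro!: table_intros\<close>)
  next
    case (3 z)
    \<comment> \<open>Adding a multiple of \<open>a\<close> to \<open>c\<close> leaves the bracket
      of \<open>a\<close> and \<open>c\<close> alone and subtracts \<open>scale z p\<close>, which
      is \<open>r\<close>, from that of \<open>b\<close> and \<open>c\<close>.\<close>
    have f': "frame (triple a b (c + scale z a))"
      using frame_triple_linear[OF f, of 1 0 z 0 1 0 0 0 1] by (simp add: det_mat3 add.commute)
    have "br a (c + scale z a) = a + b" "br b (c + scale z a) = 0"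
      using V br 3 br_anticomm[of b a] by (simp_all add: br_simps)
    then show ?thesis
      by (intro classifiedI[OF f', of "[p]" 9 0 "\<ee> 4" "\<ee> 1 + \<ee> 2" "0 *\<^sub>c \<ee> 2"])
        (use 3 A br in \<open>auto simp: params_def A_br_def intro!: table_intros\<close>)
  qed
qed

end

text \<open>A linear dependence between the two remaining brackets would put \<open>a\<close> or
  some \<open>b - scale z a\<close> into the annihilator, against the frame property.\<close>

lemma classified_abelian_pair:
  assumes f: "frame (triple a b c)" and A: "br a c \<in> Ann" "br b c \<in> Ann" and 0: "br a b = 0"
  shows classified
proof -
  have V: "a \<in> V" "b \<in> V" "c \<in> V" using frame_triple_in_V[OF f] by auto
  have "br a c \<noteq> 0"
    using in_AnnI[OF f V(1)] frame_triple_notin_Ann(1)[OF f] 0 V by (auto simp: br_self)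
  moreover have "br b c \<noteq> scale z (br a c)" for z
  proof
    assume *: "br b c = scale z (br a c)"
    have f': "frame (triple a (b - scale z a) c)"
      using frame_triple_linear[OF f, of 1 "-z" 0 0 1 0 0 0 1]
      by (simp add: det_mat3 add.commute)
    have "b - scale z a \<in> Ann"
      using V 0 * br_anticomm[of b a] by (intro in_AnnI[OF f]) (simp_all add: br_simps)
    then show False using frame_triple_notin_Ann(2)[OF f'] by simp
  qed
  ultimately have "independent {br b c, br a c}" "br b c \<noteq> br a c"
    by (rule independent_pair)+
  then show ?thesis
    by (intro classifiedI[OF f, of "[br a c, br b c]" 13 0 0 "\<ee> 4" "\<ee> 5"])
      (use A 0 in \<open>auto simp: params_def A_br_def All_less_Suc insert_commute intro!: table_intros\<close>)
qed

text \<open>A relation between the three brackets is a bivector, hence decomposable: after a linear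
  change of frame it says that two frame vectors commute. Without a relation the three brackets are
  \<open>\<ee> 4\<close>, \<open>\<ee> 5\<close>, \<open>\<ee> 6\<close> of algebra 16.\<close>

lemma classified_zero:
  assumes u: "frame u" and "structure_matrix u 0"
  shows classified
proof -
  obtain a b c r q p where f: "frame (triple a b c)" and V: "a \<in> V" "b \<in> V" "c \<in> V"
    and A: "r \<in> Ann" "q \<in> Ann" "p \<in> Ann" and br: "br b c = r" "br a c = - q" "br a b = p"
    by (rule frame_brackets[OF u assms(2)[unfolded zero_mat3]]) simp
  define q' where "q' = - q"
  have q': "q' \<in> Ann" "br a c = q'" using A br by (auto simp: q'_def Ann_closed)
  consider "independent {p, q', r}" "p \<noteq> q'" "p \<noteq> r" "q' \<noteq> r"
    | "r = 0" | z where "q' = scale z r" | y z where "p = scale y q' + scale z r"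
  proof -
    have "r = 0 \<or> (\<exists>z. q' = scale z r) \<or> (\<exists>y z. p = scale y q' + scale z r)"
      if "\<not> (independent {p, q', r} \<and> p \<noteq> q' \<and> p \<noteq> r \<and> q' \<noteq> r)"
    proof (rule ccontr)
      assume *: "\<not> ?thesis"
      have "q' \<notin> span {r}" using * by (auto simp: span_singleton)
      moreover have "p \<notin> span {q', r}"
        using * by (auto simp: span_insert span_singleton diff_eq_eq add.commute)
      moreover have "r \<notin> span {}" using * by simp
      ultimately have "independent {p, q', r}" "p \<noteq> q'" "p \<noteq> r" "q' \<noteq> r"
        using span_base[of r "{r}"] span_base[of p "{q', r}"]
        by (auto simp: independent_insert)
      then show False using that by blast
    qed
    then show thesis using that by blast
  qed
  then show ?thesis
  proof cases
    case 1
    then show ?thesis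
      by (intro classifiedI[OF f, of "[p, q', r]" 16 0 "\<ee> 4" "\<ee> 5" "\<ee> 6"])
        (use V A q' br in \<open>auto simp: params_def A_br_def All_less_Suc intro!: table_intros\<close>)
  next
    case 2
    have f': "frame (triple b c a)"
      using frame_triple_linear[OF f, of 0 0 1 1 0 0 0 1 0] by (simp add: det_mat3)
    show ?thesis
      by (rule classified_abelian_pair[OF f'])
        (use V A q' br 2 br_anticomm[of b a] br_anticomm[of c a] in \<open>simp_all add: Ann_closed\<close>)
  next
    case (3 z)
    have f': "frame (triple (a - scale z b) c b)"
      using frame_triple_linear[OF f, of 1 0 0 "-z" 0 1 0 1 0] by (simp add: det_mat3)
    show ?thesis
      by (rule classified_abelian_pair[OF f'])
        (use V A q' br 3 br_anticomm[of c b] in \<open>simp_all add: Ann_closed br_simps\<close>)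
  next
    case (4 y z)
    \<comment> \<open>The first two vectors are the factors of the bivector of the relation: their
      bracket is \<open>p - scale y q' - scale z r\<close>.\<close>
    have f': "frame (triple (a + scale z c) (b - scale y c) c)"
      using frame_triple_linear[OF f, of 1 0 0 0 1 0 z "-y" 1] by (simp add: det_mat3)
    show ?thesis
      by (rule classified_abelian_pair[OF f'])
        (use V A q' br 4 br_anticomm[of c b] in \<open>simp_all add: Ann_closed br_simps\<close>)
  qed
qed

lemma classified: classified
proof -
  obtain v where v: "frame v" by (rule frame_exists[OF dim_V dim_Ann n_ge_3])
  obtain N where N: "structure_matrix v N" by (rule frame_structure_matrix_exists[OF v])
  have *: "\<exists>u. frame u \<and> structure_matrix u N'" if "matrix_congruent N N'" for N'
    using frame_congruent[OF v N that] by blast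
  show ?thesis
    by (cases N rule: matrix_congruent_normal_form)
      (use * v N classified_zero classified_square classified_mixed classified_N1 classified_N2
        classified_N3 classified_N4 classified_N5 classified_N6 in blast)+
qed

end

section \<open>Invariants of congruence\<close>

text \<open>Scalars enter as scalar matrices, so that compatibility with congruence comes down to
  associativity of the matrix product.\<close>

definition pencil :: "'a::comm_ring_1 \<Rightarrow> 'a \<Rightarrow> 'a^'n^'n \<Rightarrow> 'a^'n^'n" where
  "pencil s t M = mat s ** M + mat t ** transpose M"

lemma pencil_congruent:
  fixes M h :: "'a::comm_ring_1^3^3"
  shows "pencil s t (h ** M ** transpose h) = h ** pencil s t M ** transpose h"
proof -
  have *: "(A + B) ** C = A ** C + B ** C" for A B C :: "'a^3^3"
    by (simp add: vec_eq_iff matrix_matrix_mult_def sum.distrib distrib_right)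
  show ?thesis
    by (simp add: pencil_def matrix_add_ldistrib * matrix_transpose_mul
        matrix_mul_assoc mat_mult_commute[of _ h])
qed

lemma pencil_mat3:
  "pencil s t (mat3 a b c d e f g h i) =
    mat3 (s*a + t*a) (s*b + t*d) (s*c + t*g) (s*d + t*b) (s*e + t*e) (s*f + t*h)
      (s*g + t*c) (s*h + t*f) (s*i + t*i)"
  by (simp add: pencil_def vec_eq_iff forall_3 matrix_matrix_mult_def sum_3 mat_def transpose_def)

lemma cof3_mat3:
  "cof3 (mat3 a b c d e f g h i) =
    mat3 (e*i - f*h) (f*g - d*i) (d*h - e*g) (c*h - b*i) (a*i - c*g) (b*g - a*h)
      (b*f - c*e) (c*d - a*f) (a*e - b*d)"
  by (simp add: cof3_def)

lemma cof3_mult: "cof3 (A ** B) = cof3 A ** cof3 B"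
  by (simp add: vec_eq_iff forall_3 cof3_def matrix_matrix_mult_def sum_3 algebra_simps)

lemma cof3_transpose: "cof3 (transpose A) = transpose (cof3 A)"
  by (simp add: vec_eq_iff forall_3 cof3_def transpose_def)

lemma det_cof3: "det (cof3 A) = det A * det A"
  by (simp add: cof3_def det_3 algebra_simps)

lemma det_nz_congruent_0:
  fixes h :: "'a::field^3^3"
  assumes "det h \<noteq> 0"
  shows "h ** M ** transpose h = 0 \<longleftrightarrow> M = 0"
proof
  assume *: "h ** M ** transpose h = 0"
  obtain k where k: "k ** h = mat 1" "h ** k = mat 1"
    using assms by (auto simp: invertible_det_nz[symmetric] invertible_def)
  have "transpose h ** transpose k = mat 1"
    using k by (metis matrix_transpose_mul transpose_mat)
  then have "M = k ** (h ** M ** transpose h) ** transpose k"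
    using k by (metis matrix_mul_assoc matrix_mul_lid matrix_mul_rid)
  then show "M = 0" by (simp add: *)
qed simp

text \<open>For a 3 by 3 matrix the three conditions mean rank 0, rank at most 2 and rank at most 1;
  the entries of \<open>cof3\<close> are the 2 by 2 minors up to sign.\<close>

lemma congruent_invariants:
  fixes M N :: "'a::field^3^3"
  assumes "matrix_congruent M N"
  shows "pencil s t M = 0 \<longleftrightarrow> pencil s t N = 0"
    and "det (pencil s t M) = 0 \<longleftrightarrow> det (pencil s t N) = 0"
    and "cof3 (pencil s t M) = 0 \<longleftrightarrow> cof3 (pencil s t N) = 0"
proof -
  obtain h where h: "det h \<noteq> 0" and N: "N = h ** M ** transpose h"
    using assms by (auto simp: matrix_congruent_def)
  show "pencil s t M = 0 \<longleftrightarrow> pencil s t N = 0"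
    unfolding N pencil_congruent by (simp add: det_nz_congruent_0[OF h])
  show "det (pencil s t M) = 0 \<longleftrightarrow> det (pencil s t N) = 0"
    unfolding N pencil_congruent using h by (simp add: det_mul)
  have "det (cof3 h) \<noteq> 0" using h by (simp add: det_cof3)
  from det_nz_congruent_0[OF this] show "cof3 (pencil s t M) = 0 \<longleftrightarrow> cof3 (pencil s t N) = 0"
    unfolding N pencil_congruent by (simp add: cof3_mult cof3_transpose)
qed

text \<open>
  For \<open>k \<in> {1..6}\<close> this is the structure matrix of the \<open>k\<close>-th algebra;
  \<open>7\<close> and \<open>8\<close> are the two forms of rank one.
\<close>

definition normal_form :: "nat \<Rightarrow> complex \<Rightarrow> complex^3^3" where
  "normal_form k \<alpha> =
    (if k = 1 then mat3 0 (-1) 0 1 0 0 0 0 0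
     else if k = 2 then mat3 0 (-1) 0 \<alpha> (-1) 0 0 0 0
     else if k = 3 then mat3 1 0 0 0 1 0 0 0 1
     else if k = 4 then mat3 0 (-1) 0 \<alpha> 0 0 0 (-1) 1
     else if k = 5 then mat3 0 0 1 1 0 0 0 0 0
     else if k = 6 then mat3 0 (-1) 0 1 0 0 0 0 1
     else if k = 7 then mat3 1 0 0 0 0 0 0 0 0
     else if k = 8 then mat3 0 (-1) 0 0 (-1) 0 0 0 0
     else mat3 0 0 0 0 0 0 0 0 0)"

lemma normal_form_pencil_0:
  "pencil s t (normal_form k \<alpha>) = 0 \<longleftrightarrow>
    (if k = 1 then s = t
     else if k = 2 then s = - t \<and> (t = 0 \<or> \<alpha> = -1)
     else if k = 4 \<or> k = 5 \<or> k = 6 \<or> k = 8 then s = 0 \<and> t = 0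
     else if k = 3 \<or> k = 7 then s + t = 0
     else True)"
proof (cases "k = 2")
  case True
  have 1: "t * \<alpha> = - t \<longleftrightarrow> t = 0 \<or> \<alpha> = -1"
    by (metis mult_cancel_left mult_minus1_right)
  have "t * \<alpha> = s \<and> s * \<alpha> = t \<and> - s = t \<longleftrightarrow> s = - t \<and> (t = 0 \<or> \<alpha> = -1)"
    unfolding 1[symmetric] by (metis add.inverse_inverse mult_minus_left)
  with True show ?thesis
    by (simp add: normal_form_def pencil_mat3 zero_mat3 mat3_eq_iff)
qed (auto simp: normal_form_def pencil_mat3 zero_mat3 mat3_eq_iff)

lemma normal_form_det:
  "det (pencil s t (normal_form k \<alpha>)) = 0 \<longleftrightarrow>
    (if k = 3 then s + t = 0
     else if k = 4 then (s - \<alpha> * t) * (\<alpha> * s - t) * (s + t) = 0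
     else if k = 6 then (s - t) * (s + t) = 0
     else True)"
  by (auto simp: normal_form_def pencil_mat3 det_mat3)

lemma normal_form_cof3:
  "cof3 (pencil s t (normal_form k \<alpha>)) = 0 \<longleftrightarrow>
    (if k = 1 then s = t
     else if k = 2 then (s - \<alpha> * t) * (\<alpha> * s - t) = 0
     else if k = 3 then s + t = 0
     else if k = 4 then s = 0 \<and> t = 0
     else if k = 5 then s = 0 \<and> t = 0
     else if k = 6 then s = t
     else if k = 8 then s * t = 0
     else True)"
  by (auto simp: normal_form_def pencil_mat3 cof3_mat3 zero_mat3 mat3_eq_iff)


text \<open>The index is detected at the form itself, at its symmetric and skew-symmetric parts, and
  at the ratios given by the two parameters. The parameter is a ratio at which the pencil drops in
  rank, hence known up to inversion, and the parameter set leaves one choice.\<close>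

lemma normal_form_congruent:
  assumes "matrix_congruent (normal_form k \<alpha>) (normal_form l \<beta>)" "k \<le> 8" "l \<le> 8"
    and \<alpha>: "\<alpha> \<in> (if k = 2 then C_gt1 \<union> {1} else if k = 4 then C_gt1 \<union> {0, 1} else {0})"
    and \<beta>: "\<beta> \<in> (if l = 2 then C_gt1 \<union> {1} else if l = 4 then C_gt1 \<union> {0, 1} else {0})"
  shows "k = l \<and> \<alpha> = \<beta>"
proof -
  note inv = congruent_invariants[OF assms(1)]
  note Z = inv(1)[unfolded normal_form_pencil_0] and D = inv(2)[unfolded normal_form_det]
    and C = inv(3)[unfolded normal_form_cof3]
  have pm: "\<alpha> = \<beta>" if "\<alpha> \<noteq> 0" "\<beta> \<noteq> 0" "\<alpha> = \<beta> \<or> \<alpha> * \<beta> = 1"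
    using that \<alpha> \<beta> C_gt1_mult_eq_1[of \<alpha> \<beta>] by (auto split: if_splits)
  have na: "\<alpha> \<noteq> 0" if "k = 2" using \<alpha> that zero_notin_C_gt1 by auto
  have nb: "\<beta> \<noteq> 0" if "l = 2" using \<beta> that zero_notin_C_gt1 by auto
  have "k \<in> {0,1,2,3,4,5,6,7,8}" "l \<in> {0,1,2,3,4,5,6,7,8}"
    using assms(2,3) by auto
  then have kl: "k = l"
    using na nb Z[of 1 0] Z[of 1 1] Z[of 1 "-1"] D[of 1 0] D[of 1 1] D[of 1 \<alpha>] D[of 1 \<beta>]
      C[of 1 0] C[of 1 1] C[of 1 \<alpha>] C[of 1 \<beta>]
    by (elim insertE emptyE) simp_all
  moreover have "\<alpha> = \<beta>"
  proof -
    consider "k = 2" | "k = 4" | "k \<noteq> 2" "k \<noteq> 4" by blast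
    then show ?thesis
    proof cases
      case 1
      then have "\<alpha> * \<beta> = 1 \<or> \<alpha> = \<beta>" using C[of 1 \<beta>] kl by auto
      then show ?thesis using pm na nb 1 kl by blast
    next
      case 2
      have zero: "\<alpha> = 0 \<longleftrightarrow> \<beta> = 0" using D[of 1 0] kl 2 by simp
      \<comment> \<open>The determinant also vanishes at \<open>s + t = 0\<close>, which adds the
        alternative -1. If both statements end in it, both parameters are -1 and agree.\<close>
      have "\<alpha> * \<beta> = 1 \<or> \<alpha> = \<beta> \<or> \<beta> = -1" "\<beta> * \<alpha> = 1 \<or> \<beta> = \<alpha> \<or> \<alpha> = -1"
        using D[of 1 \<beta>] D[of 1 \<alpha>] kl 2 by (auto simp: add_eq_0_iff)
      then consider "\<alpha> = \<beta>" | "\<alpha> * \<beta> = 1" by (metis mult.commute)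
      then show ?thesis
      proof cases
        case 2
        then have "\<alpha> \<noteq> 0" "\<beta> \<noteq> 0" by auto
        then show ?thesis using pm 2 by blast
      qed
    next
      case 3
      then show ?thesis using \<alpha> \<beta> kl by simp
    qed
  qed
  ultimately show ?thesis ..
qed

section \<open>Invariants of isomorphism\<close>

lemma algebra_iso_obtain:
  fixes sV :: "'k::field \<Rightarrow> 'v::ab_group_add \<Rightarrow> 'v" and sW :: "'k \<Rightarrow> 'w::ab_group_add \<Rightarrow> 'w"
  assumes "anticommutative_algebra sV V brV" "anticommutative_algebra sW W brW"
    and "algebra_iso sV V brV sW W brW"
  obtains f where "f ` V = W" "\<And>x y. x \<in> V \<Longrightarrow> y \<in> V \<Longrightarrow> f (x + y) = f x + f y"
    "\<And>c x. x \<in> V \<Longrightarrow> f (sV c x) = sW c (f x)"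
    "\<And>x y. x \<in> V \<Longrightarrow> y \<in> V \<Longrightarrow> f (brV x y) = brW (f x) (f y)"
    "\<And>x. x \<in> V \<Longrightarrow> f x = 0 \<longleftrightarrow> x = 0"
    "\<And>x. x \<in> V \<Longrightarrow> f x \<in> annihilator W brW \<longleftrightarrow> x \<in> annihilator V brV"
proof -
  interpret V: anticommutative_algebra sV V brV by fact
  interpret W: anticommutative_algebra sW W brW by fact
  obtain f where f: "bij_betw f V W" and add: "\<And>x y. x \<in> V \<Longrightarrow> y \<in> V \<Longrightarrow> f (x + y) = f x + f y"
    and scl: "\<And>c x. x \<in> V \<Longrightarrow> f (sV c x) = sW c (f x)"
    and br: "\<And>x y. x \<in> V \<Longrightarrow> y \<in> V \<Longrightarrow> f (brV x y) = brW (f x) (f y)"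
    using assms(3) unfolding algebra_iso_def by blast
  have im: "f ` V = W" and inj: "inj_on f V" using f by (auto simp: bij_betw_def)
  have f0: "f 0 = 0" using add[of 0 0] V.V_closed(1) by simp
  have z: "f x = 0 \<longleftrightarrow> x = 0" if "x \<in> V" for x
    using inj_onD[OF inj, of x 0] f0 that V.V_closed(1) by auto
  have "f x \<in> W" if "x \<in> V" for x using that im by blast
  then have "f x \<in> annihilator W brW \<longleftrightarrow> x \<in> annihilator V brV" if "x \<in> V" for x
    using that by (auto simp: annihilator_def im[symmetric] br[symmetric] z V.br_closed)
  with im add scl br z that show thesis by blast
qed

text \<open>Transporting \<open>u\<close> along the isomorphism puts both frames into
  \<open>W\<close>, where they differ by a change of frame. The second conclusion concerns the full
  product into the algebra: whether the three brackets of a frame satisfy a linear relation.\<close>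

lemma algebra_iso_frame:
  fixes sV :: "complex \<Rightarrow> 'v::ab_group_add \<Rightarrow> 'v" and sW :: "complex \<Rightarrow> 'w::ab_group_add \<Rightarrow> 'w"
  assumes V: "anticommutative_algebra sV V brV" and W: "anticommutative_algebra sW W brW"
    and iso: "algebra_iso sV V brV sW W brW"
    and u: "anticommutative_algebra.frame sV V brV u"
      "anticommutative_algebra.structure_matrix sV V brV u M"
    and v: "anticommutative_algebra.frame sW W brW v"
      "anticommutative_algebra.structure_matrix sW W brW v N"
  shows "matrix_congruent N M"
    and "(\<exists>w. w \<noteq> 0 \<and> anticommutative_algebra.comb sV (anticommutative_algebra.derived brV u) w = 0) \<longleftrightarrow>
      (\<exists>w. w \<noteq> 0 \<and> anticommutative_algebra.comb sW (anticommutative_algebra.derived brW v) w = 0)"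
proof -
  interpret V: anticommutative_algebra sV V brV by fact
  interpret W: anticommutative_algebra sW W brW by fact
  obtain f where im: "f ` V = W" and add: "\<And>x y. x \<in> V \<Longrightarrow> y \<in> V \<Longrightarrow> f (x + y) = f x + f y"
    and scl: "\<And>c x. x \<in> V \<Longrightarrow> f (sV c x) = sW c (f x)"
    and br: "\<And>x y. x \<in> V \<Longrightarrow> y \<in> V \<Longrightarrow> f (brV x y) = brW (f x) (f y)"
    and z: "\<And>x. x \<in> V \<Longrightarrow> f x = 0 \<longleftrightarrow> x = 0"
    and ann: "\<And>x. x \<in> V \<Longrightarrow> f x \<in> annihilator W brW \<longleftrightarrow> x \<in> annihilator V brV"
    using algebra_iso_obtain[OF V W iso] by blast
  have diff: "f (x - y) = f x - f y" if "x \<in> V" "y \<in> V" for x y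
    using add[of "x - y" y] that V.V_closed by simp
  have comb: "f (V.comb w x) = W.comb (f \<circ> w) x" if "range w \<subseteq> V" for w x
  proof -
    have "w i \<in> V" for i using that by auto
    then show ?thesis by (simp add: V.comb_def W.comb_def add scl V.V_closed)
  qed
  have uV: "u i \<in> V" for i using V.frame_in_V[OF u(1)] .
  then have ruV: "range u \<subseteq> V" by auto
  have duV: "range (V.derived u) \<subseteq> V"
    by (auto simp: V.derived_def uV V.br_closed)
  have der: "f \<circ> V.derived u = W.derived (f \<circ> u)"
    by (auto simp: V.derived_def W.derived_def br uV)
  have fu: "W.frame (f \<circ> u)"
    unfolding W.frame_def
  proof (intro conjI ballI allI impI)
    show "range (f \<circ> u) \<subseteq> W" using im uV by auto
  next
    fix y assume "y \<in> W"
    then obtain x where x: "x \<in> V" "y = f x" using im by blast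
    then obtain c where "x - V.comb u c \<in> V.Ann" using u(1) unfolding V.frame_def by blast
    then have "f (x - V.comb u c) \<in> W.Ann" using ann V.Ann_in_V by blast
    then show "\<exists>c. y - W.comb (f \<circ> u) c \<in> W.Ann"
      using x V.comb_in_V[OF ruV] by (auto simp: diff comb[OF ruV])
  next
    fix x assume "W.comb (f \<circ> u) x \<in> W.Ann"
    then have "V.comb u x \<in> V.Ann"
      using ann[OF V.comb_in_V[OF ruV]] by (simp add: comb[OF ruV])
    then show "x = 0" using u(1) unfolding V.frame_def by blast
  qed
  have fM: "W.structure_matrix (f \<circ> u) M"
    unfolding W.structure_matrix_def
  proof
    fix w
    have *: "V.comb (V.derived u) w - V.comb u (M *v w) \<in> V.Ann"
      using u(2) unfolding V.structure_matrix_def by blast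
    then have "f (V.comb (V.derived u) w - V.comb u (M *v w)) \<in> W.Ann"
      using ann V.Ann_in_V by blast
    then show "W.comb (W.derived (f \<circ> u)) w - W.comb (f \<circ> u) (M *v w) \<in> W.Ann"
      by (simp add: diff V.comb_in_V ruV duV comb der)
  qed
  obtain g where g: "det g \<noteq> 0" "g ** N = M ** cof3 g"
    and d: "\<And>w. W.comb (W.derived v) w = W.comb (W.derived (f \<circ> u)) (cof3 g *v w)"
    using W.structure_matrix_change[OF fu fM v] by blast
  \<comment> \<open>Multiplying \<open>g ** N = M ** cof3 g\<close> by the transpose of
    \<open>g\<close> gives \<open>M\<close> up to the factor \<open>det g\<close>. Scaling
    \<open>g\<close> by a square root of \<open>1 / det g\<close> removes it.\<close>
  define s where "s = csqrt (1 / det g)"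
  have s: "s * s * det g = 1" "s \<noteq> 0"
    using g(1) by (auto simp: s_def power2_eq_square[symmetric])
  show "matrix_congruent N M"
  proof (rule matrix_congruentI)
    show "det (mat s ** g) \<noteq> 0" using s g(1) by (simp add: det_mul det_mat)
    have "mat s ** g ** N ** transpose (mat s ** g) = mat s ** (g ** N) ** transpose g ** mat s"
      by (simp add: matrix_transpose_mul matrix_mul_assoc transpose_mat)
    also have "\<dots> = mat s ** M ** (cof3 g ** transpose g) ** mat s"
      by (simp add: g(2) matrix_mul_assoc)
    also have "\<dots> = mat s ** M ** mat (det g) ** mat s"
      by (simp only: cof3_mult_transpose)
    also have "\<dots> = M"
    proof -
      have "s * x * det g * s = x" for x using s(1) by algebra
      then show ?thesis
        by (simp add: vec_eq_iff forall_3 matrix_matrix_mult_def sum_3 mat_def)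
    qed
    finally show "mat s ** g ** N ** transpose (mat s ** g) = M" .
  qed
  have d': "W.comb (W.derived v) w = 0 \<longleftrightarrow> V.comb (V.derived u) (cof3 g *v w) = 0" for w
    unfolding d der[symmetric] comb[OF duV, symmetric] using z[OF V.comb_in_V[OF duV]] by simp
  \<comment> \<open>Up to the factor \<open>det g\<close> the matrices \<open>cof3 g\<close> and
    \<open>transpose g\<close> are mutually inverse, so relations are carried in both directions
    without dividing.\<close>
  have g': "cof3 g *v (transpose g *v w) = det g *s w" for w
    unfolding matrix_vector_mul_assoc cof3_mult_transpose
    by (simp add: vec_eq_iff forall_3 mat_def matrix_vector_mult_def sum_3)
  have "transpose g ** cof3 g = mat (det g)"
    using arg_cong[OF transpose_cof3_mult[of g], of transpose]
    by (simp add: matrix_transpose_mul transpose_mat)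
  then have g'': "transpose g *v (cof3 g *v w) = det g *s w" for w
    by (simp add: matrix_vector_mul_assoc)
      (simp add: vec_eq_iff forall_3 mat_def matrix_vector_mult_def sum_3)
  show "(\<exists>w. w \<noteq> 0 \<and> V.comb (V.derived u) w = 0) \<longleftrightarrow> (\<exists>w. w \<noteq> 0 \<and> W.comb (W.derived v) w = 0)"
  proof
    assume "\<exists>w. w \<noteq> 0 \<and> V.comb (V.derived u) w = 0"
    then obtain w where w: "w \<noteq> 0" "V.comb (V.derived u) w = 0" by blast
    have "transpose g *v w \<noteq> 0" using g'[of w] g(1) w(1) by auto
    moreover have "W.comb (W.derived v) (transpose g *v w) = 0"
      by (simp only: d' g' V.comb_scale w V.scale_zero_right)
    ultimately show "\<exists>w. w \<noteq> 0 \<and> W.comb (W.derived v) w = 0" by blast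
  next
    assume "\<exists>w. w \<noteq> 0 \<and> W.comb (W.derived v) w = 0"
    then obtain w where w: "w \<noteq> 0" "W.comb (W.derived v) w = 0" by blast
    have "cof3 g *v w \<noteq> 0" using g''[of w] g(1) w(1) by auto
    with w d' show "\<exists>w. w \<noteq> 0 \<and> V.comb (V.derived u) w = 0" by blast
  qed
qed

lemma algebra_iso_double_bracket_annihilator:
  fixes sV :: "'k::field \<Rightarrow> 'v::ab_group_add \<Rightarrow> 'v" and sW :: "'k \<Rightarrow> 'w::ab_group_add \<Rightarrow> 'w"
  assumes V: "anticommutative_algebra sV V brV" and W: "anticommutative_algebra sW W brW"
    and iso: "algebra_iso sV V brV sW W brW"
  shows "(\<exists>x\<in>V. \<exists>y\<in>V. \<exists>z\<in>V. brV (brV x y) z \<in> annihilator V brV - {0}) \<longleftrightarrow>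
    (\<exists>x\<in>W. \<exists>y\<in>W. \<exists>z\<in>W. brW (brW x y) z \<in> annihilator W brW - {0})"
proof -
  interpret V: anticommutative_algebra sV V brV by fact
  obtain f where im: "f ` V = W" and "\<And>x y. x \<in> V \<Longrightarrow> y \<in> V \<Longrightarrow> f (x + y) = f x + f y"
    and "\<And>c x. x \<in> V \<Longrightarrow> f (sV c x) = sW c (f x)"
    and br: "\<And>x y. x \<in> V \<Longrightarrow> y \<in> V \<Longrightarrow> f (brV x y) = brW (f x) (f y)"
    and z: "\<And>x. x \<in> V \<Longrightarrow> f x = 0 \<longleftrightarrow> x = 0"
    and ann: "\<And>x. x \<in> V \<Longrightarrow> f x \<in> annihilator W brW \<longleftrightarrow> x \<in> annihilator V brV"
    using algebra_iso_obtain[OF V W iso] by blast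
  have *: "brW (brW (f x) (f y)) (f v) \<in> annihilator W brW - {0} \<longleftrightarrow>
      brV (brV x y) v \<in> annihilator V brV - {0}" if "x \<in> V" "y \<in> V" "v \<in> V" for x y v
    using that by (simp add: br[symmetric] V.br_closed z ann)
  show ?thesis
  proof
    assume "\<exists>x\<in>V. \<exists>y\<in>V. \<exists>z\<in>V. brV (brV x y) z \<in> annihilator V brV - {0}"
    then obtain x y v where "x \<in> V" "y \<in> V" "v \<in> V" "brV (brV x y) v \<in> annihilator V brV - {0}"
      by blast
    then show "\<exists>x\<in>W. \<exists>y\<in>W. \<exists>z\<in>W. brW (brW x y) z \<in> annihilator W brW - {0}"
      using * im by (metis imageI)
  next
    assume "\<exists>x\<in>W. \<exists>y\<in>W. \<exists>z\<in>W. brW (brW x y) z \<in> annihilator W brW - {0}"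
    then obtain x y v where "x \<in> V" "y \<in> V" "v \<in> V"
      "brW (brW (f x) (f y)) (f v) \<in> annihilator W brW - {0}"
      using im by blast
    then show "\<exists>x\<in>V. \<exists>y\<in>V. \<exists>z\<in>V. brV (brV x y) z \<in> annihilator V brV - {0}"
      using * by blast
  qed
qed

text \<open>The premise \<open>nd\<close> says, coordinate by coordinate, that no nonzero
  combination of \<open>\<ee> 1\<close>, \<open>\<ee> 2\<close>, \<open>\<ee> 3\<close> commutes
  with all three; its equations come from the brackets with \<open>\<ee> 1\<close>,
  \<open>\<ee> 2\<close> and \<open>\<ee> 3\<close> in this order.\<close>

lemma table_annihilator_frame:
  assumes n: "n \<ge> 3" and pqr: "p \<in> coord_space n" "q \<in> coord_space n" "r \<in> coord_space n"
    and nd: "\<And>a b c. (\<And>k. b * p k + c * q k = 0) \<Longrightarrow> (\<And>k. a * p k - c * r k = 0) \<Longrightarrow>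
      (\<And>k. a * q k + b * r k = 0) \<Longrightarrow> a = 0 \<and> b = 0 \<and> c = 0"
  shows "annihilator (coord_space n) (table p q r) = {x \<in> coord_space n. x 1 = 0 \<and> x 2 = 0 \<and> x 3 = 0}"
    and "anticommutative_algebra.frame vscale (coord_space n) (table p q r)
      (anticommutative_algebra.triple (\<ee> 1) (\<ee> 2) (\<ee> 3))"
    and "anticommutative_algebra.structure_matrix vscale (coord_space n) (table p q r)
      (anticommutative_algebra.triple (\<ee> 1) (\<ee> 2) (\<ee> 3))
      (mat3 (r 1) (- q 1) (p 1) (r 2) (- q 2) (p 2) (r 3) (- q 3) (p 3))"
    and "anticommutative_algebra.comb vscale (anticommutative_algebra.derived (table p q r)
      (anticommutative_algebra.triple (\<ee> 1) (\<ee> 2) (\<ee> 3))) w =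
      w$1 *\<^sub>c r + w$2 *\<^sub>c (- q) + w$3 *\<^sub>c p"
proof -
  interpret anticommutative_algebra vscale "coord_space n" "table p q r"
    by (rule anticommutative_algebra_table[OF pqr])
  let ?e = "triple (\<ee> 1) (\<ee> 2) (\<ee> 3)"
  show ann: "Ann = {x \<in> coord_space n. x 1 = 0 \<and> x 2 = 0 \<and> x 3 = 0}"
  proof (intro equalityI subsetI)
    fix x assume x: "x \<in> Ann"
    then have 0: "table p q r x (\<ee> k) = 0" if "k \<in> {1, 2, 3}" for k
      using n that by (auto simp: annihilator_def e_in_coord_space)
    have "x 1 = 0 \<and> x 2 = 0 \<and> x 3 = 0"
    proof (rule nd)
      show "x 2 * p k + x 3 * q k = 0" for k
        using fun_cong[OF 0[of 1], of k] by (simp add: table_def vscale_def \<ee>_def) algebra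
      show "x 1 * p k - x 3 * r k = 0" for k
        using fun_cong[OF 0[of 2], of k] by (simp add: table_def vscale_def \<ee>_def)
      show "x 1 * q k + x 2 * r k = 0" for k
        using fun_cong[OF 0[of 3], of k] by (simp add: table_def vscale_def \<ee>_def)
    qed
    then show "x \<in> {x \<in> coord_space n. x 1 = 0 \<and> x 2 = 0 \<and> x 3 = 0}"
      using x by (simp add: annihilator_def)
  qed (auto simp: annihilator_def table_def vscale_def fun_eq_iff)
  have comb_e: "comb ?e x = (\<lambda>i. if i = 1 then x$1 else if i = 2 then x$2 else if i = 3 then x$3 else 0)" for x
    by (auto simp: comb_def vscale_def \<ee>_def)
  have e_V: "comb ?e x \<in> coord_space n" for x
    using n unfolding comb_e coord_space_def by auto
  show "frame ?e"
    unfolding frame_def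
  proof (intro conjI ballI allI impI)
    show "range ?e \<subseteq> coord_space n" using n by (auto simp: triple_def e_in_coord_space)
  next
    fix v assume "v \<in> coord_space n"
    then have "v - comb ?e (vector [v 1, v 2, v 3]) \<in> Ann"
      using e_V V_closed(3) by (simp add: ann comb_e del: One_nat_def)
    then show "\<exists>x. v - comb ?e x \<in> Ann" by blast
  next
    fix x assume "comb ?e x \<in> Ann"
    then show "x = 0" by (simp add: ann comb_e vec_eq_iff forall_3 del: One_nat_def)
  qed
  show d: "comb (derived ?e) w = w$1 *\<^sub>c r + w$2 *\<^sub>c (- q) + w$3 *\<^sub>c p" for w
  proof -
    have "table p q r (\<ee> 3) (\<ee> 1) = - q" by (simp add: table_def vscale_def \<ee>_def fun_eq_iff)
    then show ?thesis by (simp add: comb_def derived_def table_e del: One_nat_def)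
  qed
  show "structure_matrix ?e (mat3 (r 1) (- q 1) (p 1) (r 2) (- q 2) (p 2) (r 3) (- q 3) (p 3))"
    unfolding structure_matrix_def d
  proof
    fix w :: "complex^3"
    have "w$1 *\<^sub>c r + w$2 *\<^sub>c (- q) + w$3 *\<^sub>c p \<in> coord_space n"
      by (intro coord_space_closed pqr)
    then show "w $ 1 *\<^sub>c r + w $ 2 *\<^sub>c - q + w $ 3 *\<^sub>c p -
        comb ?e (mat3 (r 1) (- q 1) (p 1) (r 2) (- q 2) (p 2) (r 3) (- q 3) (p 3) *v w) \<in> Ann"
      using V_closed(3) e_V unfolding ann mem_Collect_eq
      by (simp add: comb_e vscale_def matrix_vector_mult_def sum_3 mult.commute del: One_nat_def)
  qed
qed

section \<open>Invariants of the members of the list\<close>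

lemma in_1_16:
  "i \<in> {1..16} \<longleftrightarrow> i \<in> {1, 2, 3, 4, 5, 6, 7, 8, 9, 10, 11, 12, 13, 14, 15, 16 :: nat}"
  by (simp only: atLeastAtMost_iff insert_iff empty_iff) presburger

lemma \<ee>_nth: "\<ee> j k = (if k = j then 1 else 0)"
  by (simp add: \<ee>_def)

lemma vscale_nth: "(c *\<^sub>c x) k = c * x k"
  by (simp add: vscale_def)

text \<open>Deleting \<open>\<ee> 4\<close>, \<open>\<ee> 5\<close> and \<open>\<ee> 6\<close> from
  a table leaves its structure matrix. Algebra 9 changes its form at 0, where the rank drops to one,
  and algebra 11 has the form of algebra 4 with parameter 0, which agrees with its dummy
  parameter.\<close>

definition normal_form_index :: "nat \<Rightarrow> complex \<Rightarrow> nat" where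
  "normal_form_index i \<alpha> =
    (if i = 8 then 1 else if i = 9 then (if \<alpha> = 0 then 8 else 2) else if i = 10 then 8
     else if i = 11 then 4 else if i = 12 then 5 else if i = 13 then 0 else if i = 14 then 7
     else if i = 15 then 8 else if i = 16 then 0 else i)"

lemma A_br_eq_table:
  assumes "i \<in> {1..16}"
  shows "A_br i \<alpha> = table (A_br i \<alpha> (\<ee> 1) (\<ee> 2)) (A_br i \<alpha> (\<ee> 1) (\<ee> 3)) (A_br i \<alpha> (\<ee> 2) (\<ee> 3))"
  using assms unfolding in_1_16
  by (elim insertE emptyE) (simp_all add: A_br_def table_e del: One_nat_def)

lemma A_br_nondegenerate:
  assumes "i \<in> {1..16}" "\<alpha> \<in> params i"
    and "\<And>k. b * A_br i \<alpha> (\<ee> 1) (\<ee> 2) k + c * A_br i \<alpha> (\<ee> 1) (\<ee> 3) k = 0"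
    and "\<And>k. a * A_br i \<alpha> (\<ee> 1) (\<ee> 2) k - c * A_br i \<alpha> (\<ee> 2) (\<ee> 3) k = 0"
    and "\<And>k. a * A_br i \<alpha> (\<ee> 1) (\<ee> 3) k + b * A_br i \<alpha> (\<ee> 2) (\<ee> 3) k = 0"
  shows "a = 0 \<and> b = 0 \<and> c = 0"
proof -
  \<comment> \<open>In algebra 2 with parameter 0 the vector \<open>\<ee> 2\<close> would lie in the
    annihilator.\<close>
  have \<alpha>: "i = 2 \<Longrightarrow> \<alpha> \<noteq> 0"
    using assms(2) zero_notin_C_gt1 by (auto simp: params_def)
  note e = assms(3)[of 1] assms(3)[of 2] assms(3)[of 3] assms(3)[of 4] assms(3)[of 5] assms(3)[of 6]
    assms(4)[of 1] assms(4)[of 2] assms(4)[of 3] assms(4)[of 4] assms(4)[of 5] assms(4)[of 6]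
    assms(5)[of 1] assms(5)[of 2] assms(5)[of 3] assms(5)[of 4] assms(5)[of 5] assms(5)[of 6]
  show ?thesis
    using assms(1) e \<alpha> unfolding in_1_16
    by (elim insertE emptyE)
      (simp_all add: A_br_def table_e \<ee>_nth vscale_nth del: One_nat_def)
qed


lemma A_br_structure_matrix:
  fixes p q r :: "nat \<Rightarrow> complex" and i :: nat and \<alpha> :: complex
  assumes "i \<in> {1..16}"
  defines "p \<equiv> A_br i \<alpha> (\<ee> 1) (\<ee> 2)" and "q \<equiv> A_br i \<alpha> (\<ee> 1) (\<ee> 3)"
    and "r \<equiv> A_br i \<alpha> (\<ee> 2) (\<ee> 3)"
  shows "mat3 (r 1) (- q 1) (p 1) (r 2) (- q 2) (p 2) (r 3) (- q 3) (p 3) =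
    normal_form (normal_form_index i \<alpha>) (if i = 11 then 0 else \<alpha>)"
  using assms(1) unfolding in_1_16 p_def q_def r_def
  by (elim insertE emptyE)
    (simp_all add: A_br_def table_e \<ee>_nth vscale_nth normal_form_def normal_form_index_def
      mat3_eq_iff del: One_nat_def)

text \<open>In each dependent case of the list one of the three brackets is zero, so a unit vector
  is a relation. In all other cases comparing the coordinates 1 to 6 forces
  \<open>w = 0\<close>.\<close>

lemma A_br_bracket_relation:
  fixes p q r :: "nat \<Rightarrow> complex" and i :: nat and \<alpha> :: complex
  assumes "i \<in> {1..16}" "\<alpha> \<in> params i"
  defines "p \<equiv> A_br i \<alpha> (\<ee> 1) (\<ee> 2)" and "q \<equiv> A_br i \<alpha> (\<ee> 1) (\<ee> 3)"
    and "r \<equiv> A_br i \<alpha> (\<ee> 2) (\<ee> 3)"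
  shows "(\<exists>w::complex^3. w \<noteq> 0 \<and> w$1 *\<^sub>c r + w$2 *\<^sub>c (- q) + w$3 *\<^sub>c p = 0) \<longleftrightarrow>
    i \<in> {1, 2, 5, 7, 10, 13} \<or> i \<in> {4, 9} \<and> \<alpha> = 0"
proof -
  have w: "(w::complex^3) \<noteq> 0 \<longleftrightarrow> w$1 \<noteq> 0 \<or> w$2 \<noteq> 0 \<or> w$3 \<noteq> 0" for w
    by (auto simp: vec_eq_iff forall_3)
  have ax: "axis i 1 \<noteq> (0::complex^3)" for i by (simp add: axis_eq_0_iff)
  have ax': "(axis 1 1 :: complex^3)$1 = 1" "(axis 1 1 :: complex^3)$2 = 0" "(axis 1 1 :: complex^3)$3 = 0"
    "(axis 2 1 :: complex^3)$1 = 0" "(axis 2 1 :: complex^3)$2 = 1" "(axis 2 1 :: complex^3)$3 = 0"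
    "(axis 3 1 :: complex^3)$1 = 0" "(axis 3 1 :: complex^3)$2 = 0" "(axis 3 1 :: complex^3)$3 = 1"
    by (simp_all add: axis_def)
  have dependent: "\<exists>w::complex^3. w \<noteq> 0 \<and> w$1 *\<^sub>c r + w$2 *\<^sub>c (- q) + w$3 *\<^sub>c p = 0"
    if "r = 0 \<or> q = 0 \<or> p = 0"
    using that
  proof (elim disjE)
    assume "r = 0"
    then show ?thesis using ax ax' by (intro exI[of _ "axis 1 1"]) (simp add: vscale_def fun_eq_iff)
  next
    assume "q = 0"
    then show ?thesis using ax ax' by (intro exI[of _ "axis 2 1"]) (simp add: vscale_def fun_eq_iff)
  next
    assume "p = 0"
    then show ?thesis using ax ax' by (intro exI[of _ "axis 3 1"]) (simp add: vscale_def fun_eq_iff)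
  qed
  have independent: "w = 0" if "w$1 *\<^sub>c r + w$2 *\<^sub>c (- q) + w$3 *\<^sub>c p = 0"
    "\<not> (i \<in> {1, 2, 5, 7, 10, 13} \<or> i \<in> {4, 9} \<and> \<alpha> = 0)" for w :: "complex^3"
  proof -
    have e: "w$1 * r k - w$2 * q k + w$3 * p k = 0" for k
      using fun_cong[OF that(1), of k] by (simp add: vscale_def)
    note e = e[of 1] e[of 2] e[of 3] e[of 4] e[of 5] e[of 6]
    show ?thesis
      unfolding vec_eq_iff forall_3 using assms(1) e that(2) unfolding in_1_16 p_def q_def r_def
      by (elim insertE emptyE)
        (simp_all add: A_br_def table_e \<ee>_nth vscale_nth del: One_nat_def)
  qed
  have "r = 0 \<or> q = 0 \<or> p = 0" if "i \<in> {1, 2, 5, 7, 10, 13} \<or> i \<in> {4, 9} \<and> \<alpha> = 0"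
    using that unfolding p_def q_def r_def
    by (elim insertE emptyE disjE conjE)
      (simp_all add: A_br_def table_e vscale_def fun_eq_iff del: One_nat_def)
  then show ?thesis using dependent independent by blast
qed

text \<open>The ranges start at \<open>n = 4\<close>, the lowest dimension in which non-isomorphism
  is asserted.\<close>

definition available :: "nat \<Rightarrow> nat \<Rightarrow> bool" where
  "available n i \<longleftrightarrow> i \<in> {1..16} \<and> (n \<ge> 4 \<and> i \<le> 12 \<or> n \<ge> 5 \<and> i \<le> 15 \<or> n \<ge> 6)"

lemma A_br_frame:
  assumes "available n i" "\<alpha> \<in> params i"
  defines "e \<equiv> anticommutative_algebra.triple (\<ee> 1) (\<ee> 2) (\<ee> 3)"
  shows "anticommutative_algebra vscale (coord_space n) (A_br i \<alpha>)"
    and "anticommutative_algebra.frame vscale (coord_space n) (A_br i \<alpha>) e"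
    and "anticommutative_algebra.structure_matrix vscale (coord_space n) (A_br i \<alpha>) e
      (normal_form (normal_form_index i \<alpha>) \<alpha>)"
    and "(\<exists>w. w \<noteq> 0 \<and> anticommutative_algebra.comb vscale (anticommutative_algebra.derived (A_br i \<alpha>) e) w = 0)
      \<longleftrightarrow> i \<in> {1, 2, 5, 7, 10, 13} \<or> i \<in> {4, 9} \<and> \<alpha> = 0"
    and "annihilator (coord_space n) (A_br i \<alpha>) = {x \<in> coord_space n. x 1 = 0 \<and> x 2 = 0 \<and> x 3 = 0}"
proof -
  have i: "i \<in> {1..16}" and n: "n \<ge> 3" using assms(1) by (auto simp: available_def)
  show alg: "anticommutative_algebra vscale (coord_space n) (A_br i \<alpha>)"
    by (rule anticommutative_algebra_A_br) (use assms(1) in \<open>auto simp: available_def\<close>)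
  let ?p = "A_br i \<alpha> (\<ee> 1) (\<ee> 2)" and ?q = "A_br i \<alpha> (\<ee> 1) (\<ee> 3)" and ?r = "A_br i \<alpha> (\<ee> 2) (\<ee> 3)"
  have mem: "?p \<in> coord_space n" "?q \<in> coord_space n" "?r \<in> coord_space n"
    using n by (auto intro!: anticommutative_algebra.br_closed[OF alg] e_in_coord_space)
  note T = table_annihilator_frame[OF n mem A_br_nondegenerate[OF i assms(2)], folded A_br_eq_table[OF i] e_def]
  have T4: "anticommutative_algebra.comb vscale (anticommutative_algebra.derived (A_br i \<alpha>) e) w =
      w$1 *\<^sub>c ?r + w$2 *\<^sub>c (- ?q) + w$3 *\<^sub>c ?p" for w
    by (rule T(4))
  have 11: "(if i = 11 then 0 else \<alpha>) = \<alpha>" using assms(2) by (auto simp: params_def)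
  show "anticommutative_algebra.frame vscale (coord_space n) (A_br i \<alpha>) e"
    by (rule T(2))
  show "anticommutative_algebra.structure_matrix vscale (coord_space n) (A_br i \<alpha>) e
      (normal_form (normal_form_index i \<alpha>) \<alpha>)"
    using T(3) unfolding A_br_structure_matrix[OF i] 11 .
  show "annihilator (coord_space n) (A_br i \<alpha>) = {x \<in> coord_space n. x 1 = 0 \<and> x 2 = 0 \<and> x 3 = 0}"
    by (rule T(1))
  show "(\<exists>w. w \<noteq> 0 \<and> anticommutative_algebra.comb vscale (anticommutative_algebra.derived (A_br i \<alpha>) e) w = 0)
      \<longleftrightarrow> i \<in> {1, 2, 5, 7, 10, 13} \<or> i \<in> {4, 9} \<and> \<alpha> = 0"
    unfolding T4 by (rule A_br_bracket_relation[OF i assms(2)])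
qed

text \<open>In algebra 10 every double bracket is a multiple of
  \<open>\<ee> 1 + \<ee> 2 + \<ee> 4\<close>, so it lies in the annihilator only if it is zero. In
  algebra 9 the bracket of \<open>\<ee> 1 + \<ee> 2\<close> with \<open>\<ee> 2\<close> is
  \<open>\<ee> 4\<close>.\<close>

lemma A_br_9_10_double_bracket:
  assumes "n \<ge> 4"
  shows "(\<exists>x\<in>coord_space n. \<exists>y\<in>coord_space n. \<exists>z\<in>coord_space n.
      A_br 9 0 (A_br 9 0 x y) z \<in> annihilator (coord_space n) (A_br 9 0) - {0})"
    and "\<not> (\<exists>x\<in>coord_space n. \<exists>y\<in>coord_space n. \<exists>z\<in>coord_space n.
      A_br 10 0 (A_br 10 0 x y) z \<in> annihilator (coord_space n) (A_br 10 0) - {0})"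
proof -
  have av: "available n 9" "available n 10" and par: "0 \<in> params 9" "0 \<in> params 10"
    using assms by (auto simp: available_def params_def)
  have "A_br 9 0 (A_br 9 0 (\<ee> 1) (\<ee> 3)) (\<ee> 2) = \<ee> 4"
    by (simp add: A_br_def table_def vscale_def \<ee>_def fun_eq_iff)
  moreover have "\<ee> 4 \<in> annihilator (coord_space n) (A_br 9 0) - {0}"
    using assms unfolding A_br_frame(5)[OF av(1) par(1)]
    by (auto simp: coord_space_def \<ee>_def fun_eq_iff)
  ultimately show "(\<exists>x\<in>coord_space n. \<exists>y\<in>coord_space n. \<exists>z\<in>coord_space n.
      A_br 9 0 (A_br 9 0 x y) z \<in> annihilator (coord_space n) (A_br 9 0) - {0})"
    using assms e_in_coord_space[of 1 n] e_in_coord_space[of 2 n] e_in_coord_space[of 3 n]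
    by (intro bexI[of _ "\<ee> 1"] bexI[of _ "\<ee> 3"] bexI[of _ "\<ee> 2"]) auto
  have 10: "A_br 10 0 x y = (x 1 * y 3 - x 3 * y 1) *\<^sub>c (\<ee> 1 + \<ee> 2) + (x 2 * y 3 - x 3 * y 2) *\<^sub>c \<ee> 4" for x y
    by (simp add: A_br_def table_def vscale_def fun_eq_iff)
  show "\<not> (\<exists>x\<in>coord_space n. \<exists>y\<in>coord_space n. \<exists>z\<in>coord_space n.
      A_br 10 0 (A_br 10 0 x y) z \<in> annihilator (coord_space n) (A_br 10 0) - {0})"
    unfolding A_br_frame(5)[OF av(2) par(2)] unfolding 10
    by (auto simp: vscale_def \<ee>_def fun_eq_iff)
qed

text \<open>Congruence fixes the form and the parameter. Existence of a relation between the
  brackets then separates 1 from 8, 2 from 9, 4 from 11, 5 from 12, 7 from 14, 13 from 16, and 15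
  from both 10 and 9 with parameter 0. The last two share all these invariants and are left to the
  double brackets.\<close>

lemma A_br_isomorphic_imp_eq:
  assumes "available n i" "\<alpha> \<in> params i" and "available n j" "\<beta> \<in> params j"
    and iso: "algebra_iso vscale (coord_space n) (A_br i \<alpha>) vscale (coord_space n) (A_br j \<beta>)"
  shows "i = j \<and> \<alpha> = \<beta>"
proof -
  note I = A_br_frame[OF assms(1,2)] and J = A_br_frame[OF assms(3,4)]
  have bounds: "i \<in> {1..16}" "j \<in> {1..16}" and n: "n \<ge> 4"
    using assms(1,3) by (auto simp: available_def)
  note iso' = algebra_iso_frame[OF I(1) J(1) iso I(2,3) J(2,3)]
  have le8: "normal_form_index k \<gamma> \<le> 8" if "k \<in> {1..16}" for k \<gamma>
    using that unfolding in_1_16 by (elim insertE emptyE) (simp_all add: normal_form_index_def)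
  have par: "\<gamma> \<in> (if normal_form_index k \<gamma> = 2 then C_gt1 \<union> {1}
      else if normal_form_index k \<gamma> = 4 then C_gt1 \<union> {0, 1} else {0})"
    if "k \<in> {1..16}" "\<gamma> \<in> params k" for k \<gamma>
    using that unfolding in_1_16
    by (elim insertE emptyE) (auto simp: normal_form_index_def params_def)
  have eq: "normal_form_index j \<beta> = normal_form_index i \<alpha>" "\<beta> = \<alpha>"
    using normal_form_congruent[OF iso'(1) le8 le8 par par] bounds assms(2,4) by auto
  have rel: "i \<in> {1, 2, 5, 7, 10, 13} \<or> i \<in> {4, 9} \<and> \<alpha> = 0 \<longleftrightarrow>
      j \<in> {1, 2, 5, 7, 10, 13} \<or> j \<in> {4, 9} \<and> \<alpha> = 0"
    using iso'(2) unfolding I(4) J(4) by (simp only: eq(2))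
  have "i = j \<or> \<alpha> = 0 \<and> (i = 9 \<and> j = 10 \<or> i = 10 \<and> j = 9)"
    using bounds rel eq(1) assms(2,4) zero_notin_C_gt1 unfolding in_1_16 eq(2)
    by (elim insertE emptyE) (simp_all add: normal_form_index_def params_def split: if_splits)
  then show ?thesis
    using algebra_iso_double_bracket_annihilator[OF I(1) J(1) iso] A_br_9_10_double_bracket[OF n] eq(2)
    by auto
qed

lemma pairwise_non_isomorphic_A_br:
  assumes "n = 4 \<and> m = 12 \<or> n = 5 \<and> m = 15 \<or> n = 6 \<and> m = 16"
  shows "pairwise_non_isomorphic n m"
proof -
  have "available n i" if "i \<in> {1..m}" for i
    using assms that by (auto simp: available_def)
  then show ?thesis
    unfolding pairwise_non_isomorphic_def pairwise_def members_def
    by (clarsimp simp del: atLeastAtMost_iff) (blast dest: A_br_isomorphic_imp_eq)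
qed

theorem theorem1:
  fixes n :: nat
    and scale :: "complex \<Rightarrow> 'a::ab_group_add \<Rightarrow> 'a"
    and V :: "'a set"
    and br :: "'a \<Rightarrow> 'a \<Rightarrow> 'a"
  assumes "n \<ge> 3"
    and "anticommutative_algebra scale V br"
    and "vector_space.dim scale V = n"
    and "vector_space.dim scale (annihilator V br) = n - 3"
  shows
    "(n = 3 \<longrightarrow>
       (\<exists>i\<in>{1..6}. \<exists>\<alpha>\<in>params i. algebra_iso scale V br vscale (coord_space n) (A_br i \<alpha>))) \<and>
     (n = 4 \<longrightarrow>
       (\<exists>i\<in>{1..12}. \<exists>\<alpha>\<in>params i. algebra_iso scale V br vscale (coord_space n) (A_br i \<alpha>)) \<and>
       pairwise_non_isomorphic n 12) \<and>
     (n = 5 \<longrightarrow>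
       (\<exists>i\<in>{1..15}. \<exists>\<alpha>\<in>params i. algebra_iso scale V br vscale (coord_space n) (A_br i \<alpha>)) \<and>
       pairwise_non_isomorphic n 15) \<and>
     (n = 6 \<longrightarrow>
       (\<exists>i\<in>{1..16}. \<exists>\<alpha>\<in>params i. algebra_iso scale V br vscale (coord_space n) (A_br i \<alpha>)) \<and>
       pairwise_non_isomorphic n 16) \<and>
     (n \<ge> 7 \<longrightarrow>
       (\<exists>i\<in>{1..16}. \<exists>\<alpha>\<in>params i. algebra_iso scale V br vscale (coord_space n) (A_br i \<alpha>)))"
proof -
  interpret anticommutative_algebra scale V br by fact
  interpret codim3_algebra scale V br n
    by unfold_locales (use assms in auto)
  obtain i \<alpha> where i: "i \<in> {1..6} \<or> (n \<ge> 4 \<and> i \<in> {1..12}) \<or> (n \<ge> 5 \<and> i \<in> {1..15}) \<or>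
      (n \<ge> 6 \<and> i \<in> {1..16})"
    and \<alpha>: "\<alpha> \<in> params i" and iso: "algebra_iso scale V br vscale (coord_space n) (A_br i \<alpha>)"
    using classified unfolding classified_def by blast
  have ex: "\<exists>i\<in>{1..m}. \<exists>\<alpha>\<in>params i. algebra_iso scale V br vscale (coord_space n) (A_br i \<alpha>)"
    if "i \<in> {1..m}" for m
    using that \<alpha> iso by blast
  show ?thesis
  proof (intro conjI impI)
    assume "n = 3"
    with i show "\<exists>i\<in>{1..6}. \<exists>\<alpha>\<in>params i. algebra_iso scale V br vscale (coord_space n) (A_br i \<alpha>)"
      by (intro ex) auto
  next
    assume "n = 4"
    with i show "\<exists>i\<in>{1..12}. \<exists>\<alpha>\<in>params i. algebra_iso scale V br vscale (coord_space n) (A_br i \<alpha>)"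
      by (intro ex) auto
  next
    assume "n = 5"
    with i show "\<exists>i\<in>{1..15}. \<exists>\<alpha>\<in>params i. algebra_iso scale V br vscale (coord_space n) (A_br i \<alpha>)"
      by (intro ex) auto
  next
    show "\<exists>i\<in>{1..16}. \<exists>\<alpha>\<in>params i. algebra_iso scale V br vscale (coord_space n) (A_br i \<alpha>)"
      if "n = 6" using i by (intro ex) auto
    show "\<exists>i\<in>{1..16}. \<exists>\<alpha>\<in>params i. algebra_iso scale V br vscale (coord_space n) (A_br i \<alpha>)"
      if "n \<ge> 7" using i by (intro ex) auto
  qed (simp_all add: pairwise_non_isomorphic_A_br)
qed

end
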